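(* Let $k\in\mathbb{N}$, $k\geq 2$. The function $\mathcal{F}_k(s)$ can be meromorphically continued to the whole complex plane $\mathbb{C}$, with a double pole at $s=1$, a simple pole at $s=\frac1k$, and simple poles at $s=\frac1k-\frac{(k-1)(2n+1)}{k}$ for $n=0,1,2,\dots$.
   Context: For $k\in\mathbb{N}$, Wigert's divisor function is $d^{(1/k)}(n):=\#\{d\in\mathbb{N}: d\mid n,\ d\leq n^{1/k}\}$. For $\mathrm{Re}(s)>1$, $\mathcal{F}_k(s):=\sum_{j=1}^\infty d^{(1/k)}(j)\,j^{-s}$, which equals $\sum_{m=1}^\infty\sum_{n=0}^\infty (m^k+mn)^{-s}$.
   Formalization: The simple poles at s = 1/k − (k−1)(2n+1)/k are claimed only for n with k ∤ 2n+2; when k | 2n+2 the function is holomorphic there (for k = 2, F_2 = (ζ(s)²+ζ(2s))/2 has poles only at 1 and 1/2). Holomorphy at all other points is also claimed. *)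

theory Defs
  imports "HOL-Complex_Analysis.Complex_Analysis"
begin

definition wigert_divisor :: "nat \<Rightarrow> nat \<Rightarrow> nat" where
  "wigert_divisor k n = card {d. 0 < d \<and> d dvd n \<and> real d \<le> real n powr (1 / real k)}"

(* Only meaningful for Re s > 1; the index is shifted so that the sum runs over j + 1 = 1, 2, ... *)
definition wigert_series :: "nat \<Rightarrow> complex \<Rightarrow> complex" where
  "wigert_series k s =
     (\<Sum>j. of_nat (wigert_divisor k (Suc j)) * of_nat (Suc j) powr (- s))"

(* Pitfall: not all of these points are poles.  Since
   wigert_point k n = (2 * n + 2) / k - (2 * n + 1), the point is an integer iff k dvd 2 * n + 2,
   and it then lies in {-2 * n, ..., 0}.  By Euler-Maclaurin the only contribution to the
   Dirichlet series that can be singular there is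
     B_{2n+2} / (2n+2)! * s * (s + 1) * ... * (s + 2n) * zeta (k * s + (k - 1) * (2n + 1)),
   so at an integral point the zero of the polynomial factor cancels the pole of zeta and the
   singularity is removable.  For example, for k = 2 all these points are integers, and the
   series is (zeta s ^ 2 + zeta (2 * s)) / 2, whose only poles are 1 and 1/2. *)
definition wigert_point :: "nat \<Rightarrow> nat \<Rightarrow> complex" where
  "wigert_point k n =
     1 / of_nat k - (of_nat k - 1) * (2 * of_nat n + 1) / of_nat k"

(* zorder is negative at poles, and is only informative for a function that is
   meromorphic at the point in question. *)
definition has_pole_of_order :: "(complex \<Rightarrow> complex) \<Rightarrow> complex \<Rightarrow> nat \<Rightarrow> bool" where
  "has_pole_of_order f z m \<longleftrightarrow> is_pole f z \<and> zorder f z = - int m"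

end

theory Submission
  imports Defs
begin

text \<open>
  Write $\mathcal{F}_k(s) = \sum_{m\ge1} m^{-s} H(s, m^{k-1})$ with the Hurwitz sum
  $H(s, a) = \sum_{n\ge0} (a+n)^{-s}$.  With $b_j = B_j/j!$ and $h_j(s) = \prod_{l<j}(1-s-l)$, the
  Euler--Maclaurin polynomial $Q_N(s, a) = \sum_{j\le N} b_j h_j(s) a^{1-s-j}$ is an approximate
  solution of the difference equation $Q(s, a+1) - Q(s, a) = (1-s) a^{-s}$: a Taylor expansion bounds
  the defect $D_N(s, a)$ by a multiple of $a^{-\mathrm{Re}\, s - N}$, locally uniformly in $s$.
  Telescoping gives $(s-1) H(s, a) = Q_N(s, a) + \sum_n D_N(s, a+n)$.  For $a = 1$ this continues
  $\zeta$; for $a = m^{k-1}$, multiplying by $m^{-s}$ and summing over $m$, it gives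
  \[ (s-1) \mathcal{F}_k(s) = \sum_{j\le N} b_j h_j(s)\, \zeta(k s + (k-1)(j-1)) + R_N(s) \]
  with $R_N$ holomorphic on a half-plane that grows with $N$.  The continuations to half-planes agree by
  the identity theorem, and the poles are those of the zeta terms: $j = 0$ gives $s = 1$, $j = 1$ gives
  $s = 1/k$, and $j = 2n+2$ gives the remaining ones, unless $h_j$ vanishes there.  That
  $b_{2n+2} \neq 0$ follows from a Riccati equation for $X/(e^X-1) + X/2$, which makes the signs
  alternate.
\<close>

unbundle no vec_syntax

subsection \<open>Meromorphic functions on half-planes\<close>

text \<open>On a connected open set the difference vanishes either off a sparse set or only on one,
  and the second case is impossible near a point of \<open>B\<close>. Agreement is claimed only
  around \<open>p\<close>, since the values at \<open>p\<close> itself may be arbitrary.\<close>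

lemma meromorphic_identity:
  assumes "f meromorphic_on A" "g meromorphic_on A" "open A" "connected A"
    and "open B" "B \<noteq> {}" "B \<subseteq> A" "\<And>z. z \<in> B \<Longrightarrow> f z = g z" and "p \<in> A"
  shows "eventually (\<lambda>z. f z = g z) (at p)"
proof -
  have m: "(\<lambda>z. f z - g z) meromorphic_on A"
    using assms by (intro meromorphic_intros)
  obtain b where b: "b \<in> B" using assms by auto
  consider "\<forall>\<^sub>\<approx>z\<in>A. f z - g z = 0" | "\<forall>\<^sub>\<approx>z\<in>A. f z - g z \<noteq> 0"
    using meromorphic_imp_constant_or_avoid[OF m assms(3,4), of 0] by auto
  thus ?thesis
  proof cases
    case 1
    thus ?thesis using assms by (simp add: eventually_cosparse_open_eq)
  next
    case 2
    hence "eventually (\<lambda>z. f z - g z \<noteq> 0) (at b)"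
      using assms b by (auto simp: eventually_cosparse_open_eq)
    moreover have "eventually (\<lambda>z. z \<in> B) (at b)"
      using assms b by (intro eventually_at_in_open') auto
    ultimately have "eventually (\<lambda>z. False) (at b)"
      by eventually_elim (use assms in auto)
    thus ?thesis by simp
  qed
qed

text \<open>\<open>remove_sings\<close> normalises the values at isolated singularities, so
  agreement near a point becomes equality at the point. Hence \<open>F\<close> can be defined
  pointwise from any half-plane that contains the point.\<close>

lemma meromorphic_glue_halfplanes:
  fixes f :: "nat \<Rightarrow> complex \<Rightarrow> complex"
  assumes mero: "\<And>A. f A meromorphic_on {s. Re s > - real A}"
    and eq: "\<And>A B s. Re s > 1 \<Longrightarrow> f A s = f B s"
  obtains F where "F nicely_meromorphic_on UNIV"
    and "\<And>A s. Re s > - real A \<Longrightarrow> F s = remove_sings (f A) s"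
proof -
  define F where "F s = remove_sings (f (SOME A. Re s > - real A)) s" for s
  have *: "remove_sings (f A) s = remove_sings (f B) s"
    if "Re s > - real A" "Re s > - real B" for A B s
  proof (rule remove_sings_cong)
    \<comment> \<open>The overlap of two half-planes is again a half-plane, hence connected, and it
      contains the region \<open>Re s > 1\<close> where the functions agree.\<close>
    show "eventually (\<lambda>z. f A z = f B z) (at s)"
    proof (rule meromorphic_identity)
      show "f A meromorphic_on {s. Re s > max (-real A) (-real B)}"
        "f B meromorphic_on {s. Re s > max (-real A) (-real B)}"
        using mero by (rule meromorphic_on_subset; force)+
      show "connected {s. Re s > max (-real A) (-real B)}"
        by (intro convex_connected convex_halfspace_Re_gt)
      show "open {s. Re s > max (-real A) (-real B)}" "open {s. 1 < Re s}"
        by (rule open_halfspace_Re_gt)+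
      show "{s. 1 < Re s} \<noteq> {}" by (auto intro!: exI[of _ 2])
    qed (use that eq in \<open>auto intro: eq\<close>)
  qed auto
  have F: "F s = remove_sings (f A) s" if "Re s > - real A" for A s
    unfolding F_def by (rule *[OF someI[of "\<lambda>A. Re s > - real A", OF that] that])
  have "F nicely_meromorphic_on {s}" for s
  proof -
    obtain A :: nat where "-Re s < real A" using reals_Archimedean2 by blast
    hence A: "Re s > - real A" by simp
    have n: "remove_sings (f A) nicely_meromorphic_on {s. Re s > - real A}"
      using mero by (rule remove_sings_nicely_meromorphic)
    have ev: "eventually (\<lambda>z. F z = remove_sings (f A) z) (nhds s)"
      using eventually_nhds_in_open[OF open_halfspace_Re_gt[of "- real A"], of s] A
      by (auto elim!: eventually_mono intro: F)
    hence ev': "eventually (\<lambda>z. F z = remove_sings (f A) z) (at s)"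
      by (simp add: eventually_nhds_conv_at)
    have "remove_sings (f A) meromorphic_on {s}"
      using n A by (auto simp: nicely_meromorphic_on_def intro: meromorphic_on_subset)
    hence "F meromorphic_on {s}"
      using meromorphic_on_cong[of "{s}" F "remove_sings (f A)"] ev' by auto
    moreover have "is_pole F s \<longleftrightarrow> is_pole (remove_sings (f A)) s"
      by (rule is_pole_cong[OF ev']) auto
    moreover have "(F \<midarrow>s\<rightarrow> F s) \<longleftrightarrow> (remove_sings (f A) \<midarrow>s\<rightarrow> remove_sings (f A) s)"
      using A by (intro filterlim_cong ev') (simp_all add: F[of A s])
    ultimately show ?thesis
      using n A by (auto simp: nicely_meromorphic_on_def F)
  qed
  hence "F nicely_meromorphic_on UNIV"
    unfolding nicely_meromorphic_on_def by (meson meromorphic_on_meromorphic_at singletonI)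
  from that[OF this F] show ?thesis .
qed

lemma has_pole_of_orderI:
  assumes "\<psi> analytic_on {p}" "\<psi> p \<noteq> 0" "m > 0"
    and ev: "eventually (\<lambda>s. f s = \<psi> s / (s - p) ^ m) (at p)"
  shows "has_pole_of_order f p m"
proof -
  have c: "\<psi> \<midarrow>p\<rightarrow> \<psi> p"
    using analytic_at_imp_isCont[OF assms(1)] by (simp add: isCont_def)
  have "filterlim (\<lambda>s. (s - p) ^ m) (at 0) (at p)"
    using \<open>m > 0\<close> by (auto simp: filterlim_at eventually_at_filter intro!: tendsto_eq_intros)
  hence "is_pole (\<lambda>s. \<psi> s / (s - p) ^ m) p"
    unfolding is_pole_def
    by (intro filterlim_divide_at_infinity[OF c]) (use assms in auto)
  hence 1: "is_pole f p"
    using is_pole_cong[OF ev refl] by simp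
  obtain S where S: "open S" "p \<in> S" "\<psi> holomorphic_on S"
    using assms(1) by (auto simp: analytic_at)
  obtain T where T: "open T" "p \<in> T" "\<And>s. s \<in> T \<Longrightarrow> s \<noteq> p \<Longrightarrow> f s = \<psi> s / (s - p) ^ m"
    using ev unfolding eventually_at_topological by blast
  have "zorder f p = - int m"
    by (rule zorder_eqI[of "S \<inter> T" _ \<psi>])
       (use S T assms in \<open>auto intro: holomorphic_on_subset
          simp: power_int_minus field_simps\<close>)
  with 1 show ?thesis by (simp add: has_pole_of_order_def)
qed

text \<open>The zero of the numerator makes the quotient a difference quotient, which tends to the
  derivative of \<open>\<psi>\<close> at \<open>p\<close>; a finite limit excludes a pole.\<close>

lemma not_is_pole_if_numerator_zero:
  assumes "\<psi> analytic_on {p}" "\<psi> p = 0" "\<forall>\<^sub>F s in at p. F s = \<psi> s / (s - p)"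
  shows "\<not> is_pole F p"
proof
  assume "is_pole F p"
  have "\<psi> field_differentiable at p"
    using assms(1) by (rule analytic_on_imp_differentiable_at) simp
  then obtain D where "(\<psi> has_field_derivative D) (at p)"
    by (auto simp: field_differentiable_def)
  hence "((\<lambda>s. \<psi> s / (s - p)) \<longlongrightarrow> D) (at p)"
    using assms(2) by (simp add: has_field_derivative_iff)
  hence "(F \<longlongrightarrow> D) (at p)"
    using tendsto_cong[OF assms(3)] by simp
  with \<open>is_pole F p\<close> show False
    unfolding is_pole_def using not_tendsto_and_filterlim_at_infinity at_neq_bot by blast
qed

lemma holomorphic_on_halfplane_imp_analytic_at:
  "f holomorphic_on {s. Re s > c} \<Longrightarrow> Re p > c \<Longrightarrow> f analytic_on {p}"
  by (rule holomorphic_on_imp_analytic_at[OF _ open_halfspace_Re_gt]) auto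

subsection \<open>Infinite sums\<close>

text \<open>The Weierstrass M-test along the net of finite subsets allows an arbitrary index set, so
  single and double series are treated alike.\<close>

lemma holomorphic_on_infsum:
  fixes f :: "'a \<Rightarrow> complex \<Rightarrow> complex"
  assumes "open U" and hol: "\<And>x. x \<in> X \<Longrightarrow> f x holomorphic_on U"
    and bnd: "\<And>K. compact K \<Longrightarrow> K \<subseteq> U \<Longrightarrow>
                \<exists>M. M summable_on X \<and> (\<forall>x\<in>X. \<forall>z\<in>K. norm (f x z) \<le> M x)"
  shows "(\<lambda>z. \<Sum>\<^sub>\<infinity>x\<in>X. f x z) holomorphic_on U"
proof (rule analytic_imp_holomorphic, subst analytic_on_analytic_at, intro ballI)
  fix p assume "p \<in> U"
  then obtain r where r: "r > 0" "cball p r \<subseteq> U"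
    using \<open>open U\<close> open_contains_cball by blast
  obtain M where M: "M summable_on X" "\<And>x z. x \<in> X \<Longrightarrow> z \<in> cball p r \<Longrightarrow> norm (f x z) \<le> M x"
    using bnd[OF compact_cball r(2)] by blast
  have lim: "uniform_limit (cball p r) (\<lambda>Y z. \<Sum>x\<in>Y. f x z) (\<lambda>z. \<Sum>\<^sub>\<infinity>x\<in>X. f x z) (finite_subsets_at_top X)"
    using M by (intro Weierstrass_m_test_general) auto
  have ev: "\<forall>\<^sub>F Y in finite_subsets_at_top X.
      continuous_on (cball p r) (\<lambda>z. \<Sum>x\<in>Y. f x z) \<and> (\<lambda>z. \<Sum>x\<in>Y. f x z) holomorphic_on ball p r"
  proof (rule eventually_finite_subsets_at_top_weakI)
    fix Y assume "Y \<subseteq> X"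
    hence "(\<lambda>z. \<Sum>x\<in>Y. f x z) holomorphic_on U"
      using hol by (intro holomorphic_intros) auto
    hence "(\<lambda>z. \<Sum>x\<in>Y. f x z) holomorphic_on cball p r"
      using r(2) by (rule holomorphic_on_subset)
    thus "continuous_on (cball p r) (\<lambda>z. \<Sum>x\<in>Y. f x z) \<and> (\<lambda>z. \<Sum>x\<in>Y. f x z) holomorphic_on ball p r"
      using holomorphic_on_subset[OF _ ball_subset_cball] holomorphic_on_imp_continuous_on by blast
  qed
  have "(\<lambda>z. \<Sum>\<^sub>\<infinity>x\<in>X. f x z) holomorphic_on ball p r"
    by (rule holomorphic_uniform_limit[OF ev lim]) (use finite_subsets_at_top_neq_bot in blast)+
  thus "(\<lambda>z. \<Sum>\<^sub>\<infinity>x\<in>X. f x z) analytic_on {p}"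
    using r by (intro holomorphic_on_imp_analytic_at[OF _ open_ball]) auto
qed

lemma has_sum_sum:
  fixes f :: "'i \<Rightarrow> 'a \<Rightarrow> 'b :: topological_comm_monoid_add"
  assumes "\<And>i. i \<in> I \<Longrightarrow> (f i has_sum S i) A"
  shows "((\<lambda>x. \<Sum>i\<in>I. f i x) has_sum (\<Sum>i\<in>I. S i)) A"
  using assms by (induction I rule: infinite_finite_induct) (auto intro!: has_sum_add)

lemma summable_on_powr_of_nat:
  assumes "c < -1"
  shows "(\<lambda>n. real (Suc n) powr c) summable_on UNIV"
  using assms by (subst summable_on_UNIV_nonneg_real_iff)
    (auto simp del: of_nat_Suc simp: summable_Suc_iff[of "\<lambda>n. real n powr c"] summable_real_powr_iff)

lemma summable_on_times_product:
  fixes f :: "'a \<Rightarrow> real" and g :: "'b \<Rightarrow> real"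
  assumes "f summable_on A" "g summable_on B" "\<And>x. f x \<ge> 0" "\<And>x. g x \<ge> 0"
  shows "(\<lambda>(x, y). f x * g y) summable_on A \<times> B"
proof (rule summable_on_SigmaI)
  show "((\<lambda>y. case (x, y) of (x, y) \<Rightarrow> f x * g y) has_sum (f x * infsum g B)) B" for x
    using assms by (auto intro!: has_sum_cmult_right)
  show "(\<lambda>x. f x * infsum g B) summable_on A"
    using assms by (intro summable_on_cmult_left)
qed (use assms in auto)

lemma of_nat_mult_powr: "(of_nat (x * y) :: complex) powr z = of_nat x powr z * of_nat y powr z"
  by (simp add: powr_times_real)

lemma of_nat_power_powr:
  assumes "x > 0"
  shows "(of_nat (x ^ p) :: complex) powr z = of_nat x powr (of_nat p * z)"
proof (induction p)
  case (Suc p)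
  have "(of_nat (x ^ Suc p) :: complex) powr z = of_nat x powr z * of_nat (x ^ p) powr z"
    by (simp only: power_Suc of_nat_mult_powr)
  also have "\<dots> = of_nat x powr (z + of_nat p * z)"
    unfolding Suc using assms by (simp add: powr_add)
  finally show ?case by (simp add: algebra_simps)
qed (use assms in auto)

text \<open>Raising to the \<open>k\<close>-th power makes the divisor condition purely
  arithmetical.\<close>

lemma le_root_iff_power_le:
  assumes "k > 0" "d > 0" "J > 0"
  shows "real d \<le> real J powr (1 / real k) \<longleftrightarrow> d ^ k \<le> J"
proof -
  have 1: "(real J powr (1 / real k)) ^ k = real J"
    using assms by (simp add: powr_power)
  have "real d \<le> real J powr (1 / real k) \<longleftrightarrow> real d ^ k \<le> (real J powr (1 / real k)) ^ k"
    using assms by (subst power_mono_iff) auto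
  also have "\<dots> \<longleftrightarrow> d ^ k \<le> J"
    unfolding 1 by (simp flip: of_nat_power)
  finally show ?thesis .
qed

lemma summable_on_pairs_powr_bound:
  fixes g :: "nat \<times> nat \<Rightarrow> complex"
  assumes "c > 1" "\<And>m n. norm (g (m, n)) \<le> C * (real (Suc m) powr (-c) * real (Suc n) powr (-c))"
  shows "g summable_on UNIV \<times> UNIV"
proof (rule abs_summable_summable, rule Infinite_Sum.abs_summable_on_comparison_test')
  show "(\<lambda>x. C * (case x of (m, n) \<Rightarrow> real (Suc m) powr (-c) * real (Suc n) powr (-c))) summable_on UNIV \<times> UNIV"
    using assms by (intro summable_on_cmult_right summable_on_times_product summable_on_powr_of_nat) auto
  show "norm (g x) \<le> C * (case x of (m, n) \<Rightarrow> real (Suc m) powr (-c) * real (Suc n) powr (-c))" for x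
    using assms by (cases x) auto
qed

subsection \<open>Bernoulli numbers\<close>

text \<open>The power series $(e^X - 1)/X$, whose inverse generates $B_n/n!$ with $B_1 = -1/2$.\<close>

definition exp_shift_fps :: "real fps" where
  "exp_shift_fps = Abs_fps (\<lambda>n. 1 / fact (Suc n))"

definition bernoulli_coeff :: "nat \<Rightarrow> real" where
  "bernoulli_coeff n = inverse exp_shift_fps $ n"

lemma fps_X_times_exp_shift_fps: "fps_X * exp_shift_fps = fps_exp 1 - 1"
  by (rule fps_ext) (auto simp: exp_shift_fps_def simp del: fact_Suc)

text \<open>This is \<open>b (e^X - 1) = X\<close> without a quotient. Both the recursion and the
  Riccati equation are read off from it.\<close>

lemma bernoulli_fps_times_exp: "inverse exp_shift_fps * fps_exp 1 = fps_X + inverse exp_shift_fps"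
proof -
  have "inverse exp_shift_fps * exp_shift_fps = 1"
    by (rule inverse_mult_eq_1) (simp add: exp_shift_fps_def)
  hence "inverse exp_shift_fps * (fps_X * exp_shift_fps) = fps_X"
    by (metis mult.left_commute mult.right_neutral)
  thus ?thesis unfolding fps_X_times_exp_shift_fps by (simp add: algebra_simps)
qed

lemma bernoulli_coeff_0 [simp]: "bernoulli_coeff 0 = 1"
  by (simp add: bernoulli_coeff_def exp_shift_fps_def)

text \<open>Compare the coefficients of \<open>X^m\<close> in \<open>b e^X = X + b\<close>; the
  summand \<open>X\<close> causes the exception at \<open>m = 1\<close>.\<close>

lemma sum_bernoulli_coeff:
  "(\<Sum>j\<le>m. bernoulli_coeff j / fact (m - j)) = bernoulli_coeff m + (if m = 1 then 1 else 0)"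
  using arg_cong[OF bernoulli_fps_times_exp, of "\<lambda>F. F $ m"]
  by (simp add: fps_mult_nth atLeast0AtMost bernoulli_coeff_def fps_X_def divide_inverse)

lemma bernoulli_coeff_1: "bernoulli_coeff 1 = - 1 / 2"
  \<comment> \<open>At \<open>m = 2\<close> the term \<open>bernoulli_coeff 2\<close> cancels,
    leaving \<open>1/2 + bernoulli_coeff 1 = 0\<close>.\<close>
  using sum_bernoulli_coeff[of 2] by (simp add: numeral_2_eq_2)

text \<open>This is the even function \<open>(X/2) coth (X/2)\<close>: adding \<open>X/2\<close>
  removes the linear coefficient, the only nonzero odd one.\<close>

definition even_bernoulli_fps :: "real fps" where
  "even_bernoulli_fps = inverse exp_shift_fps + fps_const (1/2) * fps_X"

lemma even_bernoulli_fps_nth: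
  "even_bernoulli_fps $ n = (if n = 1 then 0 else bernoulli_coeff n)"
  using bernoulli_coeff_1 by (auto simp: even_bernoulli_fps_def bernoulli_coeff_def fps_X_def)

text \<open>
  For $b = X/(e^X-1)$, multiply the derivative of $b e^X = X + b$ by $b$ and eliminate $e^X$.
\<close>

lemma even_bernoulli_fps_riccati:
  "fps_X * fps_deriv even_bernoulli_fps
     = even_bernoulli_fps - even_bernoulli_fps\<^sup>2 + fps_const (1/4) * fps_X\<^sup>2"
proof -
  define b where "b = inverse exp_shift_fps"
  have E: "b * fps_exp 1 = fps_X + b"
    using bernoulli_fps_times_exp by (simp add: b_def)
  have d: "fps_deriv b * fps_exp 1 + b * fps_exp 1 = 1 + fps_deriv b"
    using arg_cong[OF E, of fps_deriv] by (simp add: algebra_simps)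
  have "b * (fps_deriv b * fps_exp 1 + b * fps_exp 1) = b * (1 + fps_deriv b)"
    by (simp only: d)
  hence "fps_deriv b * (b * fps_exp 1) + b * (b * fps_exp 1) = b + b * fps_deriv b"
    by (simp add: algebra_simps)
  hence r: "fps_X * fps_deriv b = b - b * fps_X - b\<^sup>2"
    unfolding E by (simp add: algebra_simps power2_eq_square)
  have h: "fps_const (1/2 :: real) + fps_const (1/2) = 1"
     "fps_const (1/2 :: real) * fps_const (1/2) = fps_const (1/4)"
    by (simp_all flip: fps_const_add)
  have "fps_X * fps_deriv (b + fps_const (1/2) * fps_X) = fps_X * fps_deriv b + fps_const (1/2) * fps_X"
    by (simp add: algebra_simps)
  also have "\<dots> = (b + fps_const (1/2) * fps_X) - (b + fps_const (1/2) * fps_X)\<^sup>2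
       + fps_const (1/4) * fps_X\<^sup>2"
    unfolding r using h by algebra
  finally show ?thesis by (simp add: even_bernoulli_fps_def b_def)
qed

text \<open>Compare coefficients in the Riccati equation. The end terms \<open>i = 0\<close> and
  \<open>i = n\<close> of the square give \<open>2 * \<beta> n\<close>; moved to the left they
  produce the factor \<open>n + 1\<close> and leave only smaller indices on the right.\<close>

lemma even_bernoulli_fps_rec:
  assumes "n > 0"
  defines "\<beta> \<equiv> fps_nth even_bernoulli_fps"
  shows "real (n + 1) * \<beta> n = (if n = 2 then 1/4 else 0) - (\<Sum>i\<in>{0<..<n}. \<beta> i * \<beta> (n - i))"
proof -
  have "real n * \<beta> n = (fps_X * fps_deriv even_bernoulli_fps) $ n"
    using assms by (cases n) (auto simp: \<beta>_def)
  also have "\<dots> = \<beta> n - (\<Sum>i\<le>n. \<beta> i * \<beta> (n - i)) + (if n = 2 then 1/4 else 0)"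
  proof -
    have "(even_bernoulli_fps\<^sup>2) $ n = (\<Sum>i\<le>n. \<beta> i * \<beta> (n - i))"
      by (simp add: power2_eq_square fps_mult_nth atLeast0AtMost \<beta>_def)
    thus ?thesis
      unfolding even_bernoulli_fps_riccati by (simp add: \<beta>_def fps_X_power_iff)
  qed
  also have "{..n} = insert 0 (insert n {0<..<n})" using assms by auto
  also have "(\<Sum>i\<in>\<dots>. \<beta> i * \<beta> (n - i)) = 2 * \<beta> n + (\<Sum>i\<in>{0<..<n}. \<beta> i * \<beta> (n - i))"
    using assms by (simp add: even_bernoulli_fps_nth)
  finally show ?thesis by (simp add: algebra_simps)
qed

text \<open>If \<open>n\<close> is odd, each product in the recursion has a factor of smaller odd
  index.\<close>

lemma even_bernoulli_fps_nth_odd: "odd n \<Longrightarrow> even_bernoulli_fps $ n = 0"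
proof (induction n rule: less_induct)
  case (less n)
  have "(\<Sum>i\<in>{0<..<n}. even_bernoulli_fps $ i * even_bernoulli_fps $ (n - i)) = 0"
  proof (intro sum.neutral ballI)
    fix i assume i: "i \<in> {0<..<n}"
    hence "odd i \<or> odd (n - i)" using less.prems by auto
    thus "even_bernoulli_fps $ i * even_bernoulli_fps $ (n - i) = 0"
      using less.IH[of i] less.IH[of "n - i"] i by auto
  qed
  with even_bernoulli_fps_rec[of n] less.prems show ?case by (auto elim: oddE)
qed

lemma bernoulli_coeff_odd: "odd n \<Longrightarrow> n \<noteq> 1 \<Longrightarrow> bernoulli_coeff n = 0"
  using even_bernoulli_fps_nth_odd[of n] by (simp add: even_bernoulli_fps_nth)

text \<open>By induction the product of the coefficients at \<open>2 * i\<close> and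
  \<open>2 * (m - i)\<close> has sign \<open>(-1) ^ m\<close>, so no cancellation occurs in the
  recursion, and its minus sign yields \<open>(-1) ^ (m + 1)\<close>. The term \<open>1/4\<close>
  starts the induction at \<open>m = 1\<close>.\<close>

lemma even_bernoulli_fps_sign: "m > 0 \<Longrightarrow> (-1) ^ (m + 1) * even_bernoulli_fps $ (2 * m) > 0"
proof (induction m rule: less_induct)
  case (less m)
  let ?\<beta> = "fps_nth even_bernoulli_fps"
  have rec: "real (2 * m + 1) * ?\<beta> (2 * m) =
      (if 2 * m = 2 then 1/4 else 0) - (\<Sum>i\<in>{0<..<2*m}. ?\<beta> i * ?\<beta> (2 * m - i))"
    using even_bernoulli_fps_rec[of "2 * m"] less.prems by simp
  have "(\<Sum>i\<in>{0<..<2*m}. ?\<beta> i * ?\<beta> (2 * m - i)) = (\<Sum>i\<in>(*) 2 ` {0<..<m}. ?\<beta> i * ?\<beta> (2 * m - i))"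
  proof (intro sum.mono_neutral_right ballI)
    fix i assume i: "i \<in> {0<..<2*m} - (*) 2 ` {0<..<m}"
    hence "odd i" by (auto simp: image_iff elim!: evenE)
    thus "?\<beta> i * ?\<beta> (2 * m - i) = 0" by (simp add: even_bernoulli_fps_nth_odd)
  qed auto
  also have "\<dots> = (\<Sum>i\<in>{0<..<m}. ?\<beta> (2 * i) * ?\<beta> (2 * (m - i)))"
    by (subst sum.reindex) (auto simp: inj_on_def right_diff_distrib')
  finally have rec': "real (2 * m + 1) * ?\<beta> (2 * m) = (if m = 1 then 1/4 else 0) -
      (\<Sum>i\<in>{0<..<m}. ?\<beta> (2 * i) * ?\<beta> (2 * (m - i)))"
    using rec by simp
  show ?case
  proof (cases "m = 1")
    case True
    moreover have "{0<..<1::nat} = {}" by auto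
    ultimately show ?thesis using rec' by simp
  next
    case False
    have "real (2 * m + 1) * ((-1) ^ (m + 1) * ?\<beta> (2 * m)) = (-1) ^ (m + 1) * (real (2 * m + 1) * ?\<beta> (2 * m))"
      by (simp add: algebra_simps)
    also have "\<dots> = (\<Sum>i\<in>{0<..<m}. (-1) ^ m * (?\<beta> (2 * i) * ?\<beta> (2 * (m - i))))"
      unfolding rec' using False by (simp add: sum_distrib_left sum_negf)
    also have "\<dots> = (\<Sum>i\<in>{0<..<m}. ((-1) ^ (i + 1) * ?\<beta> (2 * i)) * ((-1) ^ (m - i + 1) * ?\<beta> (2 * (m - i))))"
    proof (intro sum.cong refl)
      fix i assume "i \<in> {0<..<m}"
      hence "(-1) ^ m = (-1::real) ^ (i + 1) * (-1) ^ (m - i + 1)"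
        by (simp flip: power_add)
      thus "(-1) ^ m * (?\<beta> (2 * i) * ?\<beta> (2 * (m - i))) =
        ((-1) ^ (i + 1) * ?\<beta> (2 * i)) * ((-1) ^ (m - i + 1) * ?\<beta> (2 * (m - i)))"
        by simp
    qed
    also have "\<dots> > 0"
    proof (rule sum_pos)
      have "1 \<in> {0<..<m}" using False less.prems by simp
      thus "{0<..<m} \<noteq> {}" by blast
    next
      fix i assume i: "i \<in> {0<..<m}"
      show "((-1) ^ (i + 1) * ?\<beta> (2 * i)) * ((-1) ^ (m - i + 1) * ?\<beta> (2 * (m - i))) > 0"
        by (rule mult_pos_pos[OF less.IH less.IH]) (use i in auto)
    qed auto
    finally show ?thesis by (rule zero_less_mult_pos) simp
  qed
qed

lemma bernoulli_coeff_even_nonzero: "even n \<Longrightarrow> bernoulli_coeff n \<noteq> 0"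
  using even_bernoulli_fps_sign[of "n div 2"] by (cases "n = 0") (auto simp: even_bernoulli_fps_nth)

subsection \<open>Euler--Maclaurin summation\<close>

text \<open>
  \<open>em_factor i s * x powr (1 - s - i)\<close> is the \<open>i\<close>-th derivative of \<open>x powr (1 - s)\<close>.  Starting from
  this function rather than from its multiple \<open>x powr (1 - s) / (1 - s)\<close> keeps everything entire in \<open>s\<close>.
\<close>

definition em_factor :: "nat \<Rightarrow> complex \<Rightarrow> complex" where
  "em_factor i s = (\<Prod>l<i. 1 - s - of_nat l)"

definition em_sum :: "nat \<Rightarrow> complex \<Rightarrow> nat \<Rightarrow> complex" where
  "em_sum N s a =
     (\<Sum>j\<le>N. of_real (bernoulli_coeff j) * em_factor j s * of_nat a powr (1 - s - of_nat j))"

definition em_defect :: "nat \<Rightarrow> complex \<Rightarrow> nat \<Rightarrow> complex" where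
  "em_defect N s a = em_sum N s (Suc a) - em_sum N s a - (1 - s) * of_nat a powr (- s)"

lemma em_factor_0 [simp]: "em_factor 0 s = 1"
  by (simp add: em_factor_def)

lemma em_factor_Suc: "em_factor (Suc i) s = em_factor i s * (1 - s - of_nat i)"
  by (simp add: em_factor_def)

lemma em_factor_eq_0_iff: "em_factor i s = 0 \<longleftrightarrow> (\<exists>l<i. s = 1 - of_nat l)"
  by (auto simp: em_factor_def algebra_simps)

lemma holomorphic_em_factor [holomorphic_intros]: "em_factor i holomorphic_on A"
  unfolding em_factor_def by (intro holomorphic_intros)

lemma analytic_on_em_factor: "em_factor j analytic_on A"
  using analytic_on_open[of UNIV "em_factor j"] holomorphic_em_factor analytic_on_subset by blast

lemma holomorphic_em_sum [holomorphic_intros]: "a > 0 \<Longrightarrow> (\<lambda>s. em_sum N s a) holomorphic_on A"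
  unfolding em_sum_def by (intro holomorphic_intros) auto

lemma holomorphic_em_defect [holomorphic_intros]: "a > 0 \<Longrightarrow> (\<lambda>s. em_defect N s a) holomorphic_on A"
  unfolding em_defect_def by (intro holomorphic_intros) auto

text \<open>Group the terms by total order \<open>m = j + i\<close>; each inner sum is then the
  Bernoulli recursion. The exceptional term \<open>g 1\<close> appears because
  \<open>N \<ge> 1\<close> includes \<open>m = 1\<close>.\<close>

lemma sum_bernoulli_coeff_taylor:
  assumes "N \<ge> 1"
  shows "(\<Sum>j\<le>N. of_real (bernoulli_coeff j) * (\<Sum>i\<le>N - j. g (j + i) / fact i))
       = (\<Sum>j\<le>N. of_real (bernoulli_coeff j) * g j) + (g 1 :: complex)"
proof -
  have "(\<Sum>j\<le>N. of_real (bernoulli_coeff j) * (\<Sum>i\<le>N - j. g (j + i) / fact i))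
      = (\<Sum>(j, i)\<in>{(j, i). j + i \<le> N}. of_real (bernoulli_coeff j) * (g (j + i) / fact i))"
  proof -
    have "{(j, i). j + i \<le> N} = Sigma {..N} (\<lambda>j. {..N - j})" by auto
    thus ?thesis by (simp add: sum.Sigma sum_distrib_left)
  qed
  also have "\<dots> = (\<Sum>m\<le>N. \<Sum>j\<le>m. of_real (bernoulli_coeff j) * (g (j + (m - j)) / fact (m - j)))"
    by (rule sum.triangle_reindex_eq)
  also have "\<dots> = (\<Sum>m\<le>N. g m * of_real (\<Sum>j\<le>m. bernoulli_coeff j / fact (m - j)))"
    by (intro sum.cong refl) (simp add: sum_distrib_left mult_ac)
  also have "\<dots> = (\<Sum>m\<le>N. of_real (bernoulli_coeff m) * g m + (if m = 1 then g 1 else 0))"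
    unfolding sum_bernoulli_coeff by (intro sum.cong refl) (auto simp: algebra_simps)
  also have "\<dots> = (\<Sum>j\<le>N. of_real (bernoulli_coeff j) * g j) + g 1"
    using assms by (simp add: sum.distrib)
  finally show ?thesis .
qed

text \<open>
  In the \<open>j\<close>-th term of \<open>em_sum N s (a + 1)\<close>, the \<open>j\<close>-th derivative is expanded at \<open>a\<close> up to total order
  \<open>N\<close>.  The recursion of the Bernoulli numbers cancels all Taylor coefficients except the first.
\<close>

lemma norm_em_defect_le:
  assumes "N \<ge> 1" "a \<ge> 1" "Re s + real N \<ge> 0"
  shows "norm (em_defect N s a) \<le> (\<Sum>j\<le>N. \<bar>bernoulli_coeff j\<bar> / fact (N - j)) *
           norm (em_factor (Suc N) s) * real a powr (- Re s - real N)"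
proof -
  define f where "f i x = em_factor i s * x powr (1 - s - of_nat i)" for i and x :: complex
  define S where "S = closed_segment (of_nat a :: complex) (of_nat (Suc a))"
  define B where "B = norm (em_factor (Suc N) s) * real a powr (- Re s - real N)"
  \<comment> \<open>The segment lies on the positive real axis, away from the branch cut, and there
    the norm of a power depends only on the real part of the exponent.\<close>
  have S: "\<exists>t. x = of_real t \<and> t \<ge> real a" if "x \<in> S" for x
  proof -
    have "S = of_real ` closed_segment (real a) (real (Suc a))"
      unfolding S_def closed_segment_of_real[symmetric] by simp
    thus ?thesis using that by (auto simp: closed_segment_eq_real_ivl)
  qed
  have deriv: "(f i has_field_derivative f (Suc i) x) (at x within S)" if x: "x \<in> S" for i x
  proof -
    from S[OF x] obtain t where t: "x = of_real t" "t \<ge> real a" by auto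
    have "x \<notin> \<real>\<^sub>\<le>\<^sub>0" using t \<open>a \<ge> 1\<close> by simp
    thus ?thesis unfolding f_def
      by (auto intro!: derivative_eq_intros simp: em_factor_Suc algebra_simps)
  qed
  have bound: "norm (f (Suc N) x) \<le> B" if x: "x \<in> S" for x
  proof -
    from S[OF x] obtain t where t: "x = of_real t" "t \<ge> real a" by auto
    have "norm (x powr (1 - s - of_nat (Suc N))) = t powr (- Re s - real N)"
      using t \<open>a \<ge> 1\<close> by (subst norm_powr_real_powr) auto
    \<comment> \<open>The exponent is nonpositive, so the left end of the segment gives the
      maximum.\<close>
    also have "\<dots> \<le> real a powr (- Re s - real N)"
      using t assms by (intro powr_mono2') auto
    finally show ?thesis
      unfolding f_def B_def norm_mult by (intro mult_left_mono) auto
  qed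
  \<comment> \<open>The order \<open>N - j\<close> depends on \<open>j\<close> so that every
    remainder involves the same derivative \<open>f (Suc N)\<close>, bounded by
    \<open>B\<close>.\<close>
  define R where "R j = f j (of_nat (Suc a)) - (\<Sum>i\<le>N - j. f (j + i) (of_nat a) / fact i)" for j
  have R: "norm (R j) \<le> B / fact (N - j)" if "j \<le> N" for j
  proof -
    have "norm (f (j + 0) (of_nat (Suc a)) -
            (\<Sum>i\<le>N - j. f (j + i) (of_nat a) * (of_nat (Suc a) - of_nat a) ^ i / fact i))
          \<le> B * norm (of_nat (Suc a) - of_nat a :: complex) ^ Suc (N - j) / fact (N - j)"
    proof (rule complex_Taylor[where f = "\<lambda>i. f (j + i)"])
      show "convex S" "of_nat a \<in> S" "of_nat (Suc a) \<in> S" by (simp_all add: S_def)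
    qed (use deriv bound that in auto)
    thus ?thesis by (simp add: R_def)
  qed
  have "em_sum N s (Suc a) = (\<Sum>j\<le>N. of_real (bernoulli_coeff j) * f j (of_nat (Suc a)))"
    by (simp add: em_sum_def f_def mult.assoc)
  also have "\<dots> = (\<Sum>j\<le>N. of_real (bernoulli_coeff j) * R j) +
      (\<Sum>j\<le>N. of_real (bernoulli_coeff j) * (\<Sum>i\<le>N - j. f (j + i) (of_nat a) / fact i))"
    by (simp add: R_def algebra_simps flip: sum.distrib)
  \<comment> \<open>The exceptional term \<open>g 1\<close> is here \<open>f 1\<close> at
    \<open>a\<close>, which is the right-hand side \<open>(1 - s) * a powr (- s)\<close> of the
    difference equation.\<close>
  also have "(\<Sum>j\<le>N. of_real (bernoulli_coeff j) * (\<Sum>i\<le>N - j. f (j + i) (of_nat a) / fact i)) =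
      em_sum N s a + (1 - s) * of_nat a powr (- s)"
    unfolding sum_bernoulli_coeff_taylor[OF \<open>N \<ge> 1\<close>, of "\<lambda>i. f i (of_nat a)"]
    by (simp add: em_sum_def f_def mult.assoc em_factor_Suc)
  finally have "em_defect N s a = (\<Sum>j\<le>N. of_real (bernoulli_coeff j) * R j)"
    by (simp add: em_defect_def)
  also have "norm \<dots> \<le> (\<Sum>j\<le>N. \<bar>bernoulli_coeff j\<bar> * (B / fact (N - j)))"
  proof (intro sum_norm_le)
    fix j assume "j \<in> {..N}"
    thus "norm (of_real (bernoulli_coeff j) * R j) \<le> \<bar>bernoulli_coeff j\<bar> * (B / fact (N - j))"
      unfolding norm_mult norm_of_real by (intro mult_left_mono R) auto
  qed
  also have "\<dots> = (\<Sum>j\<le>N. \<bar>bernoulli_coeff j\<bar> / fact (N - j)) * B"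
    by (simp add: sum_distrib_right)
  finally show ?thesis
    by (simp only: B_def mult.assoc)
qed

text \<open>Apart from the power of \<open>a\<close>, the bound depends on \<open>s\<close> only
  through \<open>em_factor (Suc N) s\<close>, which is bounded on a compact set.\<close>

lemma em_defect_norm_le_powr:
  assumes "N \<ge> 1" "compact K" "\<And>s. s \<in> K \<Longrightarrow> Re s + real N \<ge> 0"
  shows "\<exists>C\<ge>0. \<forall>s\<in>K. \<forall>a\<ge>1. norm (em_defect N s a) \<le> C * real a powr (- Re s - real N)"
proof -
  have "continuous_on K (em_factor (Suc N))"
    by (intro holomorphic_on_imp_continuous_on holomorphic_intros)
  hence "bounded (em_factor (Suc N) ` K)"
    using assms(2) compact_continuous_image compact_imp_bounded by blast
  then obtain M where M: "M > 0" "\<And>s. s \<in> K \<Longrightarrow> norm (em_factor (Suc N) s) \<le> M"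
    unfolding bounded_pos by auto
  define C where "C = (\<Sum>j\<le>N. \<bar>bernoulli_coeff j\<bar> / fact (N - j))"
  have C: "C \<ge> 0" unfolding C_def by (intro sum_nonneg) auto
  show ?thesis
  proof (intro exI[of _ "C * M"] conjI ballI allI impI)
    fix s and a :: nat assume "s \<in> K" "a \<ge> 1"
    hence "norm (em_defect N s a) \<le> C * norm (em_factor (Suc N) s) * real a powr (- Re s - real N)"
      unfolding C_def using assms by (intro norm_em_defect_le) auto
    also have "\<dots> \<le> C * M * real a powr (- Re s - real N)"
      using C M \<open>s \<in> K\<close> by (intro mult_right_mono mult_left_mono) auto
    finally show "norm (em_defect N s a) \<le> C * M * real a powr (- Re s - real N)" .
  qed (use C M in auto)
qed

lemma summable_em_defect:
  assumes "N \<ge> 1" "Re s + real N > 1" "a \<ge> 1"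
  shows "(\<lambda>n. norm (em_defect N s (a + n))) summable_on UNIV"
proof -
  have "\<exists>C\<ge>0. \<forall>t\<in>{s}. \<forall>a\<ge>1. norm (em_defect N t a) \<le> C * real a powr (- Re t - real N)"
    by (rule em_defect_norm_le_powr) (use assms in auto)
  then obtain C where C: "C \<ge> 0"
      "\<And>a. a \<ge> 1 \<Longrightarrow> norm (em_defect N s a) \<le> C * real a powr (- Re s - real N)"
    by blast
  show ?thesis
  proof (rule Infinite_Sum.abs_summable_on_comparison_test')
    show "(\<lambda>n. C * real (Suc n) powr (- Re s - real N)) summable_on UNIV"
      using assms by (intro summable_on_cmult_right summable_on_powr_of_nat) auto
    fix n :: nat
    have "norm (em_defect N s (a + n)) \<le> C * real (a + n) powr (- Re s - real N)"
      using assms by (intro C) auto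
    also have "\<dots> \<le> C * real (Suc n) powr (- Re s - real N)"
      using assms C by (intro mult_left_mono powr_mono2') auto
    finally show "norm (em_defect N s (a + n)) \<le> C * real (Suc n) powr (- Re s - real N)" .
  qed
qed

lemma em_sum_tendsto_0:
  assumes "Re s > 1"
  shows "(\<lambda>n. em_sum N s (a + n)) \<longlonglongrightarrow> 0"
  unfolding em_sum_def
proof (rule tendsto_null_sum)
  fix j assume "j \<in> {..N}"
  have "(\<lambda>n. real n powr (1 - Re s - real j)) \<longlonglongrightarrow> 0"
    using assms by (intro tendsto_neg_powr filterlim_real_sequentially) auto
  from LIMSEQ_ignore_initial_segment[OF this, of a]
  have "(\<lambda>n. real (a + n) powr (1 - Re s - real j)) \<longlonglongrightarrow> 0"
    by (simp only: add.commute)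
  hence "(\<lambda>n. norm (of_nat (a + n) powr (1 - s - of_nat j) :: complex)) \<longlonglongrightarrow> 0"
    by (simp add: norm_powr_real_powr)
  hence "(\<lambda>n. of_nat (a + n) powr (1 - s - of_nat j) :: complex) \<longlonglongrightarrow> 0"
    by (rule tendsto_norm_zero_cancel)
  thus "(\<lambda>n. of_real (bernoulli_coeff j) * em_factor j s * of_nat (a + n) powr (1 - s - of_nat j)) \<longlonglongrightarrow> 0"
    by (rule tendsto_mult_right_zero)
qed

text \<open>Sum the definition of \<open>em_defect\<close> over \<open>a, a + 1, ...\<close>: the
  differences of \<open>em_sum\<close> telescope, and the boundary term at infinity vanishes for
  \<open>Re s > 1\<close>.\<close>

lemma hurwitz_euler_maclaurin:
  assumes "N \<ge> 1" "Re s > 1" "a \<ge> 1"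
  shows "((\<lambda>n. (1 - s) * of_nat (a + n) powr (- s)) has_sum
            (- em_sum N s a - (\<Sum>\<^sub>\<infinity>n. em_defect N s (a + n)))) UNIV"
proof (rule norm_summable_imp_has_sum)
  have "(\<lambda>n. norm ((1 - s) * of_nat (a + n) powr (- s))) summable_on UNIV"
  proof (rule Infinite_Sum.abs_summable_on_comparison_test')
    show "(\<lambda>n. norm (1 - s) * real (Suc n) powr (- Re s)) summable_on UNIV"
      using assms by (intro summable_on_cmult_right summable_on_powr_of_nat) auto
    fix n :: nat
    have "norm ((1 - s) * of_nat (a + n) powr (- s)) = norm (1 - s) * real (a + n) powr (- Re s)"
      by (simp add: norm_mult norm_powr_real_powr)
    also have "\<dots> \<le> norm (1 - s) * real (Suc n) powr (- Re s)"
      using assms by (intro mult_left_mono powr_mono2') auto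
    finally show "norm ((1 - s) * of_nat (a + n) powr (- s)) \<le> norm (1 - s) * real (Suc n) powr (- Re s)" .
  qed
  thus "summable (\<lambda>n. norm ((1 - s) * of_nat (a + n) powr (- s)))"
    by (rule summable_on_imp_summable)
next
  have "(\<lambda>n. em_sum N s (a + n) - em_sum N s (a + Suc n)) sums (em_sum N s (a + 0) - 0)"
    by (rule telescope_sums') (rule em_sum_tendsto_0[OF assms(2)])
  from sums_minus[OF this]
  have 1: "(\<lambda>n. em_sum N s (a + Suc n) - em_sum N s (a + n)) sums (- em_sum N s a)"
    by simp
  have "(\<lambda>n. em_defect N s (a + n)) summable_on UNIV"
    by (rule abs_summable_summable, rule summable_em_defect) (use assms in auto)
  hence "(\<lambda>n. em_defect N s (a + n)) sums (\<Sum>\<^sub>\<infinity>n. em_defect N s (a + n))"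
    by (intro has_sum_imp_sums has_sum_infsum)
  from sums_diff[OF 1 this]
  show "(\<lambda>n. (1 - s) * of_nat (a + n) powr (- s)) sums
          (- em_sum N s a - (\<Sum>\<^sub>\<infinity>n. em_defect N s (a + n)))"
    by (simp add: em_defect_def)
qed

subsection \<open>Continuation of the zeta function\<close>

lemma em_factor_1: "j > 0 \<Longrightarrow> em_factor j 1 = 0"
  by (auto simp: em_factor_eq_0_iff intro!: exI[of _ 0])

text \<open>Every \<open>em_factor j\<close> with \<open>j > 0\<close> contains the factor
  \<open>1 - s\<close>, so only \<open>j = 0\<close> survives. This will show that zeta has residue
  1 at \<open>s = 1\<close>.\<close>

lemma em_sum_1:
  assumes "a > 0"
  shows "em_sum N 1 a = 1"
proof -
  have "em_sum N 1 a = (\<Sum>j\<in>{0}. of_real (bernoulli_coeff j) * em_factor j 1 * of_nat a powr (1 - 1 - of_nat j))"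
    unfolding em_sum_def by (rule sum.mono_neutral_right) (auto simp: em_factor_1)
  thus ?thesis using assms by simp
qed

lemma em_defect_1: "a > 0 \<Longrightarrow> em_defect N 1 a = 0"
  by (simp add: em_defect_def em_sum_1)

lemma holomorphic_em_defect_series:
  "(\<lambda>s. \<Sum>\<^sub>\<infinity>n. em_defect (2 * A + 4) s (Suc n)) holomorphic_on {s. Re s > - real A}"
proof (rule holomorphic_on_infsum)
  fix K assume K: "compact K" "K \<subseteq> {s. Re s > - real A}"
  have Re: "Re s > - real A" if "s \<in> K" for s using K that by auto
  have "\<exists>C\<ge>0. \<forall>s\<in>K. \<forall>a\<ge>1. norm (em_defect (2 * A + 4) s a)
          \<le> C * real a powr (- Re s - real (2 * A + 4))"
    by (rule em_defect_norm_le_powr) (use K Re in force)+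
  then obtain C where C: "C \<ge> 0" "\<And>s a. s \<in> K \<Longrightarrow> a \<ge> 1 \<Longrightarrow>
      norm (em_defect (2 * A + 4) s a) \<le> C * real a powr (- Re s - real (2 * A + 4))"
    by blast
  show "\<exists>M. M summable_on UNIV \<and> (\<forall>n\<in>UNIV. \<forall>s\<in>K. norm (em_defect (2 * A + 4) s (Suc n)) \<le> M n)"
  proof (intro exI[of _ "\<lambda>n. C * real (Suc n) powr (-2)"] conjI ballI)
    show "(\<lambda>n. C * real (Suc n) powr (-2)) summable_on UNIV"
      by (intro summable_on_cmult_right summable_on_powr_of_nat) auto
    fix n :: nat and s assume s: "s \<in> K"
    have "norm (em_defect (2 * A + 4) s (Suc n)) \<le> C * real (Suc n) powr (- Re s - real (2 * A + 4))"
      using s by (intro C) auto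
    \<comment> \<open>Since \<open>- Re s < A\<close>, the exponent is below \<open>- A - 4\<close>,
      and so below \<open>-2\<close>.\<close>
    also have "\<dots> \<le> C * real (Suc n) powr (-2)"
      using Re[OF s] C by (intro mult_left_mono powr_mono) auto
    finally show "norm (em_defect (2 * A + 4) s (Suc n)) \<le> C * real (Suc n) powr (-2)" .
  qed
next
  fix n :: nat
  show "(\<lambda>s. em_defect (2 * A + 4) s (Suc n)) holomorphic_on {s. Re s > - real A}"
    by (rule holomorphic_em_defect) simp
qed (rule open_halfspace_Re_gt)

text \<open>The entire function \<open>Z\<close> is \<open>(s - 1)\<close> times zeta; working with
  it keeps the pole of zeta as an explicit denominator.\<close>

lemma zeta_continuation:
  obtains Z :: "complex \<Rightarrow> complex" where "Z holomorphic_on UNIV" "Z 1 = 1"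
    "\<And>s. Re s > 1 \<Longrightarrow> ((\<lambda>n. of_nat (Suc n) powr (- s)) has_sum (Z s / (s - 1))) UNIV"
proof -
  define f where "f A s = em_sum (2 * A + 4) s 1 + (\<Sum>\<^sub>\<infinity>n. em_defect (2 * A + 4) s (Suc n))" for A s
  have hol: "f A holomorphic_on {s. Re s > - real A}" for A
    unfolding f_def by (intro holomorphic_intros holomorphic_em_defect_series) auto
  have f: "((\<lambda>n. (1 - s) * of_nat (Suc n) powr (- s)) has_sum (- f A s)) UNIV" if "Re s > 1" for s A
    using hurwitz_euler_maclaurin[of "2 * A + 4" s 1] that by (simp add: f_def)
  obtain Z where Z: "\<And>A s. Re s > - real A \<Longrightarrow> Z s = remove_sings (f A) s"
  proof (rule meromorphic_glue_halfplanes)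
    show "f A meromorphic_on {s. Re s > - real A}" for A
      using hol by (intro analytic_on_imp_meromorphic_on)
        (simp add: analytic_on_open open_halfspace_Re_gt)
    show "f A s = f B s" if "Re s > 1" for A B s
      using has_sum_unique[OF f[OF that, of A] f[OF that, of B]] by simp
  qed blast
  \<comment> \<open>Each \<open>f A\<close> is analytic on its half-plane, so
    \<open>remove_sings\<close> changes nothing there.\<close>
  have Z': "Z s = f A s" if "Re s > - real A" for s A
  proof -
    have "f A analytic_on {s}"
      using hol that by (rule holomorphic_on_halfplane_imp_analytic_at)
    thus ?thesis using Z[OF that] by simp
  qed
  have "Z analytic_on {p}" for p
  proof -
    obtain A :: nat where "- Re p < real A" using reals_Archimedean2 by blast
    hence "Re p > - real A" by simp
    moreover have "Z holomorphic_on {s. Re s > - real A}"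
      using hol[of A] by (rule holomorphic_transform) (simp add: Z')
    ultimately show ?thesis
      using holomorphic_on_halfplane_imp_analytic_at by blast
  qed
  hence "Z holomorphic_on UNIV"
    by (meson analytic_imp_holomorphic analytic_on_analytic_at)
  moreover have "Z 1 = 1"
    using Z'[of 0 1] by (simp add: f_def em_sum_1 em_defect_1)
  moreover have "((\<lambda>n. of_nat (Suc n) powr (- s)) has_sum (Z s / (s - 1))) UNIV" if "Re s > 1" for s
  proof -
    have s: "1 - s \<noteq> 0" using that by auto
    have "((\<lambda>n. inverse (1 - s) * ((1 - s) * of_nat (Suc n) powr (- s))) has_sum
            (inverse (1 - s) * (- f 0 s))) UNIV"
      by (intro has_sum_cmult_right f that)
    also have "(\<lambda>n. inverse (1 - s) * ((1 - s) * of_nat (Suc n) powr (- s))) = (\<lambda>n. of_nat (Suc n) powr (- s))"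
      using s by (simp add: mult.assoc[symmetric])
    also have "inverse (1 - s) * (- f 0 s) = Z s / (s - 1)"
      using that s Z'[of 0 s] by (simp add: field_simps)
    finally show ?thesis .
  qed
  ultimately show ?thesis by (rule that)
qed

subsection \<open>Wigert's divisor series\<close>

lemma wigert_divisor_Suc:
  assumes "k > 0"
  shows "wigert_divisor k (Suc j) = card {d. d dvd Suc j \<and> d ^ k \<le> Suc j}"
proof -
  have "{d. 0 < d \<and> d dvd Suc j \<and> real d \<le> real (Suc j) powr (1 / real k)}
      = {d. d dvd Suc j \<and> d ^ k \<le> Suc j}"
    using le_root_iff_power_le[OF assms, of _ "Suc j"] by (auto simp del: of_nat_Suc dest: dvd_pos_nat[rotated])
  thus ?thesis by (simp add: wigert_divisor_def)
qed

text \<open>Pairs correspond to divisors: with \<open>d = m + 1\<close> and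
  \<open>J = d * (d ^ (k - 1) + n)\<close>, \<open>d\<close> divides \<open>J\<close> and
  \<open>d ^ k \<le> J\<close>; conversely \<open>n = J div d - d ^ (k - 1)\<close>. The code
  carries \<open>j = J - 1\<close> and \<open>m = d - 1\<close>. Each \<open>J\<close> is hit once
  for every divisor that Wigert's function counts.\<close>

lemma wigert_series_eq_double_sum:
  assumes "k \<ge> 2"
    and sum: "((\<lambda>(m, n). of_nat (Suc m) powr (- s) * of_nat (Suc m ^ (k - 1) + n) powr (- s)) has_sum S)
                (UNIV \<times> UNIV)"
  shows "wigert_series k s = S"
proof -
  define D where "D j = {d. d dvd Suc j \<and> d ^ k \<le> Suc j}" for j
  define l where "l = k - 1"
  have k: "k = Suc l" using assms by (simp add: l_def)
  have fin: "finite (D j)" for j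
    by (rule finite_subset[of _ "{..Suc j}"]) (auto simp: D_def dest: dvd_imp_le)
  have "((\<lambda>(j, d). of_nat (Suc j) powr (- s)) has_sum S) (Sigma UNIV D)"
  proof (rule iffD1[OF has_sum_reindex_bij_witness[where
            j = "\<lambda>(m, n). (Suc m * (Suc m ^ l + n) - 1, Suc m)" and
            i = "\<lambda>(j, d). (d - 1, Suc j div d - d ^ l)"] sum])
    show "(case a of (m, n) \<Rightarrow> (Suc m * (Suc m ^ l + n) - 1, Suc m)) \<in> Sigma UNIV D" for a
    proof -
      obtain m n where [simp]: "a = (m, n)" by force
      have "Suc (Suc m * (Suc m ^ l + n) - 1) = Suc m * (Suc m ^ l + n)"
        by simp
      thus ?thesis by (simp add: D_def k del: mult_Suc)
    qed
    show "(case (case a of (m, n) \<Rightarrow> (Suc m * (Suc m ^ l + n) - 1, Suc m)) of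
            (j, d) \<Rightarrow> (d - 1, Suc j div d - d ^ l)) = a" for a
    proof -
      obtain m n where [simp]: "a = (m, n)" by force
      have "Suc (Suc m * (Suc m ^ l + n) - 1) = Suc m * (Suc m ^ l + n)"
        by simp
      thus ?thesis by (simp del: mult_Suc)
    qed
    show "(case (case b of (j, d) \<Rightarrow> (d - 1, Suc j div d - d ^ l)) of
            (m, n) \<Rightarrow> (Suc m * (Suc m ^ l + n) - 1, Suc m)) = b" if "b \<in> Sigma UNIV D" for b
    proof -
      obtain j d where b [simp]: "b = (j, d)" by force
      have "d dvd Suc j" and le: "d * d ^ l \<le> Suc j" using that by (auto simp: D_def k)
      then obtain e where e: "Suc j = d * e" by blast
      hence d: "d > 0" by (auto intro!: Nat.gr0I)
      \<comment> \<open>The size condition on \<open>d\<close> is what makes the truncated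
        subtraction exact.\<close>
      have "d ^ l \<le> e" using le d unfolding e by simp
      hence "d * (d ^ l + (Suc j div d - d ^ l)) = Suc j" using d unfolding e by simp
      moreover have "Suc (d - 1) = d" using d by simp
      ultimately show ?thesis by (simp del: mult_Suc)
    qed
    show "(case (case a of (m, n) \<Rightarrow> (Suc m * (Suc m ^ l + n) - 1, Suc m)) of
              (j, d) \<Rightarrow> of_nat (Suc j) powr (- s)) =
           (case a of (m, n) \<Rightarrow> (of_nat (Suc m) powr (- s) * of_nat (Suc m ^ (k - 1) + n) powr (- s) :: complex))" for a
    proof -
      obtain m n where [simp]: "a = (m, n)" by force
      have "Suc (Suc m * (Suc m ^ l + n) - 1) = Suc m * (Suc m ^ l + n)"
        by simp
      thus ?thesis
        by (simp add: k of_nat_mult_powr[symmetric] del: mult_Suc of_nat_Suc of_nat_mult of_nat_add)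
    qed
  qed auto
  moreover have "((\<lambda>d. case (j, d) of (j, d) \<Rightarrow> of_nat (Suc j) powr (- s)) has_sum
                   (of_nat (wigert_divisor k (Suc j)) * of_nat (Suc j) powr (- s))) (D j)" for j
  proof (rule has_sum_finiteI)
    show "of_nat (wigert_divisor k (Suc j)) * of_nat (Suc j) powr (- s) =
      (\<Sum>d\<in>D j. case (j, d) of (j, d) \<Rightarrow> of_nat (Suc j) powr (- s))"
      using assms by (simp add: wigert_divisor_Suc D_def)
  qed (rule fin)
  ultimately have "((\<lambda>j. of_nat (wigert_divisor k (Suc j)) * of_nat (Suc j) powr (- s)) has_sum S) UNIV"
    by (rule has_sum_SigmaD)
  hence "(\<lambda>j. of_nat (wigert_divisor k (Suc j)) * of_nat (Suc j) powr (- s)) sums S"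
    by (rule has_sum_imp_sums)
  thus ?thesis unfolding wigert_series_def by (rule sums_unique[symmetric])
qed

text \<open>
  The truncation order \<open>2 * A + 4\<close> makes the sum of the defects converge on \<open>Re s > - A\<close>: there
  the factor \<open>m powr (- s)\<close> costs at most \<open>m powr A\<close>, while the defect at \<open>a \<ge> max m (n + 1)\<close> is
  \<open>O(a powr (- A - 4))\<close>.
\<close>

definition wigert_defect :: "nat \<Rightarrow> nat \<Rightarrow> complex \<Rightarrow> nat \<times> nat \<Rightarrow> complex" where
  "wigert_defect k A s = (\<lambda>(m, n). of_nat (Suc m) powr (- s) * em_defect (2 * A + 4) s (Suc m ^ (k - 1) + n))"

text \<open>Collecting exponents in \<open>m powr (- s) * (m ^ (k - 1)) powr (1 - s - j)\<close>
  gives \<open>m powr (- zeta_arg k j s)\<close>. The subtraction is complex, so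
  \<open>j = 0\<close> contributes \<open>- (k - 1)\<close>.\<close>

definition zeta_arg :: "nat \<Rightarrow> nat \<Rightarrow> complex \<Rightarrow> complex" where
  "zeta_arg k j s = of_nat k * s + (of_nat k - 1) * (of_nat j - 1)"

section \<open>Convergence of the double series and the Euler--Maclaurin formula for
  \<open>wigert_series\<close>\<close>

context
  fixes k :: nat
  assumes k: "k \<ge> 2"
begin

text \<open>Because \<open>k - 1 \<ge> 1\<close>, the Hurwitz argument dominates both indices; decay
  in it therefore gives decay in \<open>m\<close> and in \<open>n\<close>.\<close>

lemma Suc_le_Suc_power_add: "Suc m \<le> Suc m ^ (k - 1) + n" "Suc n \<le> Suc m ^ (k - 1) + n"
proof -
  have "Suc m ^ 1 \<le> Suc m ^ (k - 1)" using k by (intro power_increasing) auto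
  thus "Suc m \<le> Suc m ^ (k - 1) + n" "Suc n \<le> Suc m ^ (k - 1) + n" by auto
qed

lemma wigert_terms_summable:
  assumes "Re s > 1"
  shows "(\<lambda>(m, n). (of_nat (Suc m) powr (- s) * of_nat (Suc m ^ (k - 1) + n) powr (- s) :: complex))
           summable_on UNIV \<times> UNIV"
proof (rule summable_on_pairs_powr_bound[where C = 1])
  fix m n :: nat
  have "real (Suc m) powr (- Re s) * real (Suc m ^ (k - 1) + n) powr (- Re s)
       \<le> real (Suc m) powr (- Re s) * real (Suc n) powr (- Re s)"
    using assms Suc_le_Suc_power_add(2)[of n m] by (intro mult_left_mono powr_mono2') auto
  thus "norm (case (m, n) of (m, n) \<Rightarrow> (of_nat (Suc m) powr (- s) * of_nat (Suc m ^ (k - 1) + n) powr (- s) :: complex))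
        \<le> 1 * (real (Suc m) powr (- Re s) * real (Suc n) powr (- Re s))"
    by (simp add: norm_mult norm_powr_real_powr del: of_nat_Suc of_nat_add of_nat_power power_Suc)
qed (use assms in auto)

lemma wigert_defect_bound:
  assumes "compact K" "K \<subseteq> {s. Re s > - real A}"
  shows "\<exists>C. \<forall>s\<in>K. \<forall>m n. norm (wigert_defect k A s (m, n)) \<le> C * (real (Suc m) powr (-2) * real (Suc n) powr (-2))"
proof -
  have Re: "Re s > - real A" if "s \<in> K" for s using assms that by auto
  have "\<exists>C\<ge>0. \<forall>s\<in>K. \<forall>a\<ge>1. norm (em_defect (2 * A + 4) s a)
          \<le> C * real a powr (- Re s - real (2 * A + 4))"
    by (rule em_defect_norm_le_powr) (use assms Re in force)+
  then obtain C where C: "C \<ge> 0" "\<And>s a. s \<in> K \<Longrightarrow> a \<ge> 1 \<Longrightarrow>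
      norm (em_defect (2 * A + 4) s a) \<le> C * real a powr (- Re s - real (2 * A + 4))"
    by blast
  show ?thesis
  proof (intro exI[of _ C] ballI allI)
    fix s m n assume s: "s \<in> K"
    define a where "a = Suc m ^ (k - 1) + n"
    have a: "a \<ge> Suc m" "a \<ge> Suc n"
      unfolding a_def by (rule Suc_le_Suc_power_add)+
    have "norm (wigert_defect k A s (m, n)) = real (Suc m) powr (- Re s) * norm (em_defect (2 * A + 4) s a)"
      by (simp add: wigert_defect_def a_def norm_mult norm_powr_real_powr del: of_nat_Suc of_nat_add of_nat_power power_Suc)
    also have "\<dots> \<le> real (Suc m) powr real A * (C * real a powr (- Re s - real (2 * A + 4)))"
      using Re[OF s] s a C by (intro mult_mono powr_mono C) auto
    \<comment> \<open>The exponent, at most \<open>- A - 4\<close>, is split in two: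
      \<open>- (A + 2)\<close> will be spent on \<open>m\<close>, absorbing the growth
      \<open>m powr A\<close>, and \<open>-2\<close> on \<open>n\<close>.\<close>
    also have "\<dots> \<le> real (Suc m) powr real A * (C * real a powr (- real (A + 2) + (-2)))"
      using Re[OF s] a C by (intro mult_left_mono powr_mono) auto
    also have "\<dots> = C * (real (Suc m) powr real A * (real a powr (- real (A + 2)) * real a powr (-2)))"
      unfolding powr_add by (simp add: mult_ac)
    also have "\<dots> \<le> C * (real (Suc m) powr real A * (real (Suc m) powr (- real (A + 2)) * real (Suc n) powr (-2)))"
      using a C by (intro mult_left_mono mult_mono powr_mono2') auto
    also have "\<dots> = C * ((real (Suc m) powr real A * real (Suc m) powr (- real (A + 2))) * real (Suc n) powr (-2))"
      by (simp only: mult.assoc)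
    also have "real (Suc m) powr real A * real (Suc m) powr (- real (A + 2)) = real (Suc m) powr (-2)"
      by (simp flip: powr_add)
    finally show "norm (wigert_defect k A s (m, n)) \<le> C * (real (Suc m) powr (-2) * real (Suc n) powr (-2))" .
  qed
qed

lemma wigert_defect_summable:
  assumes "Re s > - real A"
  shows "wigert_defect k A s summable_on UNIV \<times> UNIV"
proof -
  obtain C where "\<forall>t\<in>{s}. \<forall>m n. norm (wigert_defect k A t (m, n)) \<le> C * (real (Suc m) powr (-2) * real (Suc n) powr (-2))"
    using wigert_defect_bound[of "{s}" A] assms by auto
  thus ?thesis by (intro summable_on_pairs_powr_bound[where c = 2]) auto
qed

lemma holomorphic_wigert_defect:
  "(\<lambda>s. infsum (wigert_defect k A s) (UNIV \<times> UNIV)) holomorphic_on {s. Re s > - real A}"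
proof (rule holomorphic_on_infsum)
  fix K assume K: "compact K" "K \<subseteq> {s. Re s > - real A}"
  obtain C where C: "\<forall>s\<in>K. \<forall>m n. norm (wigert_defect k A s (m, n)) \<le> C * (real (Suc m) powr (-2) * real (Suc n) powr (-2))"
    using wigert_defect_bound[OF K] ..
  show "\<exists>M. M summable_on UNIV \<times> UNIV \<and> (\<forall>x\<in>UNIV \<times> UNIV. \<forall>s\<in>K. norm (wigert_defect k A s x) \<le> M x)"
  proof (intro exI conjI ballI)
    show "(\<lambda>x. C * (case x of (m, n) \<Rightarrow> real (Suc m) powr (-2) * real (Suc n) powr (-2))) summable_on UNIV \<times> UNIV"
      by (intro summable_on_cmult_right summable_on_times_product summable_on_powr_of_nat) auto
    show "norm (wigert_defect k A s x) \<le> C * (case x of (m, n) \<Rightarrow> real (Suc m) powr (-2) * real (Suc n) powr (-2))"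
      if "s \<in> K" for s x
      using C that by (cases x) (simp del: of_nat_Suc)
  qed
next
  fix x :: "nat \<times> nat"
  have "Suc (fst x) ^ (k - 1) + snd x > 0" by (simp add: add_pos_nonneg)
  moreover have "(of_nat (Suc (fst x)) :: complex) \<noteq> 0" by (simp only: of_nat_eq_0_iff)
  ultimately show "(\<lambda>s. wigert_defect k A s x) holomorphic_on {s. Re s > - real A}"
    unfolding wigert_defect_def case_prod_unfold
    by (intro holomorphic_on_mult holomorphic_em_defect holomorphic_on_powr_right
          holomorphic_on_minus holomorphic_on_ident)
qed (rule open_halfspace_Re_gt)

text \<open>Thus for \<open>Re s > 1\<close> all zeta terms lie in the region where their Dirichlet
  series converge and can be summed over \<open>m\<close>.\<close>

lemma Re_zeta_arg:
  assumes "Re s > 1"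
  shows "Re (zeta_arg k j s) > 1"
proof -
  have "real k * Re s + (real k - 1) * (real j - 1) - 1 = real k * (Re s - 1) + (real k - 1) * real j"
    by (simp add: algebra_simps)
  moreover have "real k * (Re s - 1) > 0" "(real k - 1) * real j \<ge> 0"
    using assms k by (auto intro: mult_pos_pos)
  ultimately show ?thesis by (simp add: zeta_arg_def)
qed

lemma wigert_series_euler_maclaurin:
  assumes Z: "\<And>s. Re s > 1 \<Longrightarrow> ((\<lambda>n. of_nat (Suc n) powr (- s)) has_sum (Z s / (s - 1))) UNIV"
    and s: "Re s > 1"
  shows "wigert_series k s =
    ((\<Sum>j\<le>2 * A + 4. of_real (bernoulli_coeff j) * em_factor j s * (Z (zeta_arg k j s) / (zeta_arg k j s - 1)))
      + infsum (wigert_defect k A s) (UNIV \<times> UNIV)) / (s - 1)"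
proof -
  define N where "N = 2 * A + 4"
  define S where "S = (\<Sum>j\<le>N. of_real (bernoulli_coeff j) * em_factor j s * (Z (zeta_arg k j s) / (zeta_arg k j s - 1)))"
  define R where "R = infsum (wigert_defect k A s) (UNIV \<times> UNIV)"
  define a where "a m = Suc m ^ (k - 1)" for m
  have a: "a m \<ge> 1" for m by (simp add: a_def)
  have sA: "Re s > - real A" using s by linarith
  have "((\<lambda>m. \<Sum>j\<le>N. of_real (bernoulli_coeff j) * em_factor j s * of_nat (Suc m) powr (- zeta_arg k j s)) has_sum S) UNIV"
    unfolding S_def by (intro has_sum_sum has_sum_cmult_right Z Re_zeta_arg s)
  also have "(\<lambda>m. \<Sum>j\<le>N. of_real (bernoulli_coeff j) * em_factor j s * of_nat (Suc m) powr (- zeta_arg k j s)) =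
             (\<lambda>m. of_nat (Suc m) powr (- s) * em_sum N s (a m))"
  proof (rule ext)
    fix m
    have "of_nat (Suc m) powr (- s) * of_nat (a m) powr (1 - s - of_nat j) = (of_nat (Suc m) powr (- zeta_arg k j s) :: complex)" for j
    proof -
      have "of_nat (Suc m) powr (- s) * of_nat (a m) powr (1 - s - of_nat j) =
            (of_nat (Suc m) powr (- s + of_nat (k - 1) * (1 - s - of_nat j)) :: complex)"
        unfolding a_def of_nat_power_powr[OF zero_less_Suc] powr_add ..
      also have "- s + of_nat (k - 1) * (1 - s - of_nat j) = - zeta_arg k j s"
        using k by (simp add: zeta_arg_def of_nat_diff algebra_simps)
      finally show ?thesis .
    qed
    hence "of_nat (Suc m) powr (- zeta_arg k j s) = (of_nat (Suc m) powr (- s) * of_nat (a m) powr (1 - s - of_nat j) :: complex)" for j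
      by simp
    thus "(\<Sum>j\<le>N. of_real (bernoulli_coeff j) * em_factor j s * of_nat (Suc m) powr (- zeta_arg k j s)) =
        of_nat (Suc m) powr (- s) * em_sum N s (a m)"
      unfolding em_sum_def sum_distrib_left by (intro sum.cong refl) (simp only: mult_ac)
  qed
  finally have S: "((\<lambda>m. of_nat (Suc m) powr (- s) * em_sum N s (a m)) has_sum S) UNIV" .
  have R: "((\<lambda>m. of_nat (Suc m) powr (- s) * (\<Sum>\<^sub>\<infinity>n. em_defect N s (a m + n))) has_sum R) UNIV"
  proof (rule has_sum_SigmaD)
    show "(wigert_defect k A s has_sum R) (UNIV \<times> UNIV)"
      unfolding R_def using wigert_defect_summable[OF sA] by (rule has_sum_infsum)
    have "(\<lambda>n. em_defect N s (a m + n)) summable_on UNIV" for m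
      by (rule abs_summable_summable, rule summable_em_defect) (use a s in \<open>auto simp: N_def\<close>)
    thus "((\<lambda>n. wigert_defect k A s (m, n)) has_sum of_nat (Suc m) powr (- s) * (\<Sum>\<^sub>\<infinity>n. em_defect N s (a m + n))) UNIV" for m
      unfolding wigert_defect_def prod.case a_def N_def
      by (intro has_sum_cmult_right has_sum_infsum)
  qed
  define g where "g = (\<lambda>(m, n). (of_nat (Suc m) powr (- s) * of_nat (Suc m ^ (k - 1) + n) powr (- s) :: complex))"
  have "((\<lambda>x. (1 - s) * g x) has_sum (- S - R)) (UNIV \<times> UNIV)"
  proof (rule has_sum_SigmaI)
    show "((\<lambda>n. (1 - s) * g (m, n)) has_sum
            (of_nat (Suc m) powr (- s) * (- em_sum N s (a m) - (\<Sum>\<^sub>\<infinity>n. em_defect N s (a m + n))))) UNIV" for m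
    proof -
      have "((\<lambda>n. of_nat (Suc m) powr (- s) * ((1 - s) * of_nat (a m + n) powr (- s))) has_sum
            (of_nat (Suc m) powr (- s) * (- em_sum N s (a m) - (\<Sum>\<^sub>\<infinity>n. em_defect N s (a m + n))))) UNIV"
        using a s by (intro has_sum_cmult_right hurwitz_euler_maclaurin) (auto simp: N_def)
      thus ?thesis by (simp only: g_def prod.case a_def mult_ac)
    qed
    have "((\<lambda>m. - (of_nat (Suc m) powr (- s) * em_sum N s (a m)) +
               - (of_nat (Suc m) powr (- s) * (\<Sum>\<^sub>\<infinity>n. em_defect N s (a m + n)))) has_sum (- S + - R)) UNIV"
      by (intro has_sum_add has_sum_uminusI S R)
    thus "((\<lambda>m. of_nat (Suc m) powr (- s) * (- em_sum N s (a m) - (\<Sum>\<^sub>\<infinity>n. em_defect N s (a m + n)))) has_sum (- S - R)) UNIV"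
      by (simp only: distrib_left mult_minus_right diff_conv_add_uminus)
    \<comment> \<open>Summability over all pairs is what allows the double sum to be evaluated row
      by row.\<close>
    show "(\<lambda>x. (1 - s) * g x) summable_on UNIV \<times> UNIV"
      unfolding g_def by (intro summable_on_cmult_right wigert_terms_summable s)
  qed
  hence "((\<lambda>x. inverse (1 - s) * ((1 - s) * g x)) has_sum (inverse (1 - s) * (- S - R))) (UNIV \<times> UNIV)"
    by (rule has_sum_cmult_right)
  moreover have s1: "1 - s \<noteq> 0" using s by auto
  ultimately have "(g has_sum (inverse (1 - s) * (- S - R))) (UNIV \<times> UNIV)"
    by (simp add: mult.assoc[symmetric])
  hence "wigert_series k s = inverse (1 - s) * (- S - R)"
    unfolding g_def by (rule wigert_series_eq_double_sum[OF k])
  also have "\<dots> = (S + R) / (s - 1)"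
    using s1 by (simp add: field_simps)
  finally show ?thesis by (simp only: S_def R_def N_def)
qed

section \<open>Location of the singularities of the zeta terms\<close>

lemma zeta_arg_eq_1_iff: "zeta_arg k j p = 1 \<longleftrightarrow> p = (1 - (of_nat k - 1) * (of_nat j - 1)) / of_nat k"
  using k by (auto simp: zeta_arg_def field_simps)

text \<open>Since \<open>k \<noteq> 1\<close>, at most one zeta term is singular at a given point,
  so singular terms cannot cancel each other.\<close>

lemma zeta_arg_eq_1_unique:
  assumes "zeta_arg k i p = 1" "zeta_arg k j p = 1"
  shows "i = j"
proof -
  have "(of_nat k - 1) * (of_nat i - 1) = (of_nat k - 1) * (of_nat j - 1 :: complex)"
    using assms unfolding zeta_arg_def by (metis add_left_cancel)
  moreover have "of_nat k \<noteq> (1 :: complex)"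
    using k by (metis of_nat_1 of_nat_eq_iff one_neq_zero numeral_le_one_iff semiring_norm(69))
  ultimately show ?thesis by simp
qed

lemma zeta_arg_0_1: "zeta_arg k 0 1 = 1"
  by (simp add: zeta_arg_def)

lemma zeta_arg_1: "zeta_arg k 1 (1 / of_nat k) = 1"
  using k by (simp add: zeta_arg_def)

lemma zeta_arg_even_eq_1_iff: "zeta_arg k (2 * n + 2) p = 1 \<longleftrightarrow> p = wigert_point k n"
proof -
  have "(1 - (of_nat k - 1) * (of_nat (2 * n + 2) - 1)) / of_nat k = wigert_point k n"
    by (simp add: wigert_point_def diff_divide_distrib add_ac)
  thus ?thesis by (simp only: zeta_arg_eq_1_iff)
qed

text \<open>The zeros of the factor are the integers \<open>1 - l\<close> with
  \<open>l < 2 * n + 2\<close>. Multiplying by \<open>k\<close> turns equality with such a zero into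
  \<open>2 * n + 2 = k * (2 * n + 2 - l)\<close>.\<close>

lemma em_factor_wigert_point: "em_factor (2 * n + 2) (wigert_point k n) = 0 \<longleftrightarrow> k dvd 2 * n + 2"
proof -
  have k0: "of_nat k \<noteq> (0 :: complex)" using k by simp
  have wp: "of_nat k * wigert_point k n = of_nat (2 * n + 2) - of_nat k * (2 * of_nat n + 1)"
    using k0 by (simp add: wigert_point_def field_simps)
  have iff: "wigert_point k n = 1 - of_nat l \<longleftrightarrow> 2 * n + 2 = k * (2 * n + 2 - l)" if l: "l < 2 * n + 2" for l
  proof -
    have "wigert_point k n = 1 - of_nat l \<longleftrightarrow> of_nat k * wigert_point k n = of_nat k * (1 - of_nat l)"
      using k0 by simp
    also have "\<dots> \<longleftrightarrow> of_nat (2 * n + 2) = (of_nat k * (of_nat (2 * n + 2) - of_nat l) :: complex)"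
      unfolding wp by (auto simp: algebra_simps)
    also have "of_nat k * (of_nat (2 * n + 2) - of_nat l) = (of_nat (k * (2 * n + 2 - l)) :: complex)"
      using l by (simp add: of_nat_diff)
    finally show ?thesis by (simp only: of_nat_eq_iff)
  qed
  show ?thesis
  proof
    assume "em_factor (2 * n + 2) (wigert_point k n) = 0"
    then obtain l where "l < 2 * n + 2" "wigert_point k n = 1 - of_nat l"
      unfolding em_factor_eq_0_iff by blast
    thus "k dvd 2 * n + 2" using iff by (metis dvd_triv_left)
  next
    assume "k dvd 2 * n + 2"
    then obtain q where q: "2 * n + 2 = k * q" by blast
    have "q > 0" using q by (intro Nat.gr0I) simp
    moreover have "q \<le> 2 * n + 2" unfolding q using k by simp
    \<comment> \<open>The witness is \<open>l = 2 * n + 2 - q\<close> with \<open>q\<close> the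
      quotient; \<open>q > 0\<close> keeps it in range.\<close>
    ultimately have "2 * n + 2 - q < 2 * n + 2" "2 * n + 2 = k * (2 * n + 2 - (2 * n + 2 - q))"
      using q by simp_all
    thus "em_factor (2 * n + 2) (wigert_point k n) = 0"
      unfolding em_factor_eq_0_iff using iff by blast
  qed
qed

section \<open>Local behaviour of the continuation\<close>

lemma analytic_on_zeta_arg_compose:
  assumes "Z holomorphic_on UNIV"
  shows "(\<lambda>s. Z (zeta_arg k j s)) analytic_on A"
proof -
  have "(\<lambda>s. Z (zeta_arg k j s)) holomorphic_on UNIV"
    unfolding zeta_arg_def
    by (rule holomorphic_on_compose_gen[OF _ assms, unfolded o_def]) (auto intro: holomorphic_intros)
  thus ?thesis using analytic_on_open analytic_on_subset by blast
qed

lemma analytic_on_zeta_arg: "zeta_arg k j analytic_on A"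
  unfolding zeta_arg_def by (intro analytic_intros)

text \<open>If the argument is 1 at \<open>p\<close>, then
  \<open>zeta_arg k j s - 1 = k * (s - p)\<close>, and \<open>Z 1 = 1\<close> gives the residue.
  Otherwise the term is analytic at \<open>p\<close> and multiplying by \<open>s - p\<close> yields
  a numerator with value 0. The common form lets the terms be added.\<close>

lemma em_term_principal_part:
  fixes j :: nat and p :: complex
  assumes Z: "Z holomorphic_on UNIV" "Z 1 = 1"
  defines "T \<equiv> \<lambda>s. of_real (bernoulli_coeff j) * em_factor j s * (Z (zeta_arg k j s) / (zeta_arg k j s - 1))"
  shows "\<exists>\<psi>. \<psi> analytic_on {p} \<and>
           \<psi> p = (if zeta_arg k j p = 1 then of_real (bernoulli_coeff j) * em_factor j p / of_nat k else 0) \<and>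
           (\<forall>s. s \<noteq> p \<longrightarrow> T s = \<psi> s / (s - p))"
proof (cases "zeta_arg k j p = 1")
  case True
  define \<psi> where "\<psi> s = of_real (bernoulli_coeff j) * em_factor j s * Z (zeta_arg k j s) / of_nat k" for s
  have "zeta_arg k j s - 1 = of_nat k * (s - p)" for s
    unfolding True[symmetric] by (simp add: zeta_arg_def algebra_simps)
  hence "T s = \<psi> s / (s - p)" for s
    by (simp add: T_def \<psi>_def)
  moreover have "\<psi> analytic_on {p}"
    unfolding \<psi>_def using k
    by (intro analytic_on_mult analytic_on_divide analytic_on_const analytic_on_em_factor
          analytic_on_zeta_arg_compose Z) auto
  ultimately show ?thesis
    using True Z by (intro exI[of _ \<psi>]) (simp add: \<psi>_def)
next
  case False
  have "T analytic_on {p}"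
    unfolding T_def using False
    by (intro analytic_on_mult analytic_on_divide analytic_on_diff analytic_on_const analytic_on_em_factor
          analytic_on_zeta_arg_compose analytic_on_zeta_arg Z) auto
  hence "(\<lambda>s. (s - p) * T s) analytic_on {p}"
    by (intro analytic_on_mult analytic_on_diff analytic_on_const analytic_on_ident)
  thus ?thesis using False by (intro exI[of _ "\<lambda>s. (s - p) * T s"]) simp
qed

text \<open>The denominator keeps the factor \<open>s - 1\<close> by which the Euler--Maclaurin
  formula was divided; at \<open>p = 1\<close> it joins \<open>s - p\<close> to make a double pole.
  The value of the numerator at \<open>p\<close> decides whether there is a singularity.\<close>

lemma wigert_series_continuation:
  "\<exists>F. F nicely_meromorphic_on UNIV \<and> (\<forall>s. Re s > 1 \<longrightarrow> F s = wigert_series k s) \<and>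
    (\<forall>j p. zeta_arg k j p = 1 \<longrightarrow> (\<exists>\<psi>. \<psi> analytic_on {p} \<and>
        \<psi> p = of_real (bernoulli_coeff j) * em_factor j p / of_nat k \<and>
        (\<forall>\<^sub>F s in at p. F s = \<psi> s / ((s - p) * (s - 1))))) \<and>
    (\<forall>p. (\<forall>j. zeta_arg k j p \<noteq> 1) \<longrightarrow> (\<exists>\<psi>. \<psi> analytic_on {p} \<and> \<psi> p = 0 \<and>
        (\<forall>\<^sub>F s in at p. F s = \<psi> s / ((s - p) * (s - 1)))))"
proof -
  obtain Z :: "complex \<Rightarrow> complex" where Z: "Z holomorphic_on UNIV" "Z 1 = 1"
    and Z_sum: "\<And>s. Re s > 1 \<Longrightarrow> ((\<lambda>n. of_nat (Suc n) powr (- s)) has_sum (Z s / (s - 1))) UNIV"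
    by (rule zeta_continuation) (rule that)
  define T where "T j s = of_real (bernoulli_coeff j) * em_factor j s * (Z (zeta_arg k j s) / (zeta_arg k j s - 1))"
    for j s
  define R where "R A s = infsum (wigert_defect k A s) (UNIV \<times> UNIV)" for A s
  define f where "f A s = ((\<Sum>j\<le>2 * A + 4. T j s) + R A s) / (s - 1)" for A s
  have R: "R A analytic_on {s. Re s > - real A}" for A
    unfolding R_def using holomorphic_wigert_defect[of A] open_halfspace_Re_gt[of "- real A"]
    by (simp add: analytic_on_open)
  have f: "f A s = wigert_series k s" if "Re s > 1" for A s
    unfolding f_def T_def R_def
    by (rule wigert_series_euler_maclaurin[OF Z_sum that, symmetric])
  have mero: "f A meromorphic_on {s. Re s > - real A}" for A
    unfolding f_def T_def
    by (intro meromorphic_on_divide meromorphic_on_add meromorphic_on_sum meromorphic_on_mult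
          meromorphic_on_diff meromorphic_on_const meromorphic_on_id analytic_on_imp_meromorphic_on[OF R]
          analytic_on_imp_meromorphic_on[OF analytic_on_em_factor]
          analytic_on_imp_meromorphic_on[OF analytic_on_zeta_arg]
          analytic_on_imp_meromorphic_on[OF analytic_on_zeta_arg_compose[OF Z(1)]])
  obtain F where F: "F nicely_meromorphic_on UNIV"
    and F_eq: "\<And>A s. Re s > - real A \<Longrightarrow> F s = remove_sings (f A) s"
  proof (rule meromorphic_glue_halfplanes[of f])
    show "f A meromorphic_on {s. Re s > - real A}" for A
      by (rule mero)
    show "f A s = f B s" if "Re s > 1" for A B s
      using f[OF that] by simp
  qed (rule that)
  have F_series: "F s = wigert_series k s" if "Re s > 1" for s
  proof -
    have "T j analytic_on {s}" for j
    proof -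
      have "zeta_arg k j s \<noteq> 1" using Re_zeta_arg[OF that, of j] by auto
      thus ?thesis unfolding T_def
        by (intro analytic_on_mult analytic_on_divide analytic_on_diff analytic_on_const analytic_on_em_factor
          analytic_on_zeta_arg_compose analytic_on_zeta_arg Z) auto
    qed
    moreover have "R 0 analytic_on {s}"
      by (rule analytic_on_subset[OF R]) (use that in auto)
    ultimately have "f 0 analytic_on {s}"
      unfolding f_def using that
      by (intro analytic_on_divide analytic_on_add analytic_on_sum analytic_on_diff analytic_on_const analytic_on_ident)
        auto
    hence "remove_sings (f 0) s = f 0 s" by simp
    thus ?thesis using F_eq[of 0 s] f[OF that] that by simp
  qed
  have at_pt: "\<exists>\<psi>. \<psi> analytic_on {p} \<and>
      \<psi> p = (\<Sum>j\<le>2 * A + 4. if zeta_arg k j p = 1 then of_real (bernoulli_coeff j) * em_factor j p / of_nat k else 0) \<and>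
      (\<forall>\<^sub>F s in at p. F s = \<psi> s / ((s - p) * (s - 1)))" if p: "Re p > - real A" for A p
  proof -
    have "\<exists>\<psi>. \<psi> analytic_on {p} \<and>
           \<psi> p = (if zeta_arg k j p = 1 then of_real (bernoulli_coeff j) * em_factor j p / of_nat k else 0) \<and>
           (\<forall>s. s \<noteq> p \<longrightarrow> T j s = \<psi> s / (s - p))" for j
      unfolding T_def by (rule em_term_principal_part[OF Z])
    hence "\<exists>\<psi>. \<forall>j. \<psi> j analytic_on {p} \<and>
           \<psi> j p = (if zeta_arg k j p = 1 then of_real (bernoulli_coeff j) * em_factor j p / of_nat k else 0) \<and>
           (\<forall>s. s \<noteq> p \<longrightarrow> T j s = \<psi> j s / (s - p))"
      by (intro choice allI)
    then obtain \<psi> where \<psi>: "\<And>j. \<psi> j analytic_on {p}"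
       "\<And>j. \<psi> j p = (if zeta_arg k j p = 1 then of_real (bernoulli_coeff j) * em_factor j p / of_nat k else 0)"
       "\<And>j s. s \<noteq> p \<Longrightarrow> T j s = \<psi> j s / (s - p)"
      by blast
    \<comment> \<open>With the common denominator \<open>s - p\<close>, the analytic remainder
      \<open>R A\<close> contributes nothing to the value at \<open>p\<close>.\<close>
    define \<phi> where "\<phi> s = (\<Sum>j\<le>2 * A + 4. \<psi> j s) + (s - p) * R A s" for s
    have "R A analytic_on {p}"
      by (rule analytic_on_subset[OF R]) (use p in auto)
    hence "\<phi> analytic_on {p}"
      unfolding \<phi>_def
      by (intro analytic_on_add analytic_on_sum analytic_on_mult analytic_on_diff analytic_on_const analytic_on_ident \<psi>)
    moreover have "\<phi> p = (\<Sum>j\<le>2 * A + 4. if zeta_arg k j p = 1 then of_real (bernoulli_coeff j) * em_factor j p / of_nat k else 0)"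
      by (simp add: \<phi>_def \<psi>(2))
    moreover have "\<forall>\<^sub>F s in at p. F s = \<phi> s / ((s - p) * (s - 1))"
    proof -
      have "isolated_singularity_at (f A) p"
        by (rule meromorphic_on_isolated_singularity, rule meromorphic_on_subset[OF mero[of A]]) (use p in auto)
      hence "\<forall>\<^sub>F s in at p. remove_sings (f A) s = f A s"
        by (rule eventually_remove_sings_eq_at)
      moreover have "\<forall>\<^sub>F s in at p. s \<in> {s. Re s > - real A}"
        by (rule eventually_at_in_open'[OF open_halfspace_Re_gt]) (use p in simp)
      moreover have "\<forall>\<^sub>F s in at p. s \<noteq> p"
        by (rule eventually_neq_at_within)
      ultimately show ?thesis
      proof eventually_elim
        case (elim s)
        have "\<phi> s / (s - p) = (\<Sum>j\<le>2 * A + 4. T j s) + R A s"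
          using elim by (simp add: \<phi>_def \<psi>(3) add_divide_distrib sum_divide_distrib)
        hence "f A s = \<phi> s / (s - p) / (s - 1)"
          by (simp add: f_def)
        thus ?case using elim F_eq[of A s] by simp
      qed
    qed
    ultimately show ?thesis by blast
  qed
  show ?thesis
  proof (rule exI[of _ F], intro conjI allI impI F F_series)
    fix j p assume j: "zeta_arg k j p = 1"
    obtain B :: nat where B: "- Re p < real B" using reals_Archimedean2 by blast
    \<comment> \<open>The half-plane must contain \<open>p\<close>, and the truncation order
      \<open>2 * A + 4\<close> must reach the index \<open>j\<close>.\<close>
    define A where "A = max B j"
    have A: "Re p > - real A" "j \<le> A" using B by (auto simp: A_def)
    have "(\<Sum>i\<le>2 * A + 4. if zeta_arg k i p = 1 then of_real (bernoulli_coeff i) * em_factor i p / of_nat k else 0)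
        = (\<Sum>i\<le>2 * A + 4. if j = i then of_real (bernoulli_coeff i) * em_factor i p / of_nat k else 0)"
      using j zeta_arg_eq_1_unique by (intro sum.cong refl if_cong) blast
    also have "\<dots> = of_real (bernoulli_coeff j) * em_factor j p / of_nat k"
      using A by simp
    finally show "\<exists>\<psi>. \<psi> analytic_on {p} \<and>
        \<psi> p = of_real (bernoulli_coeff j) * em_factor j p / of_nat k \<and>
        (\<forall>\<^sub>F s in at p. F s = \<psi> s / ((s - p) * (s - 1)))"
      using at_pt[OF A(1)] by simp
  next
    fix p assume p: "\<forall>j. zeta_arg k j p \<noteq> 1"
    obtain A :: nat where "- Re p < real A" using reals_Archimedean2 by blast
    hence "Re p > - real A" by simp
    from at_pt[OF this]
    show "\<exists>\<psi>. \<psi> analytic_on {p} \<and> \<psi> p = 0 \<and> (\<forall>\<^sub>F s in at p. F s = \<psi> s / ((s - p) * (s - 1)))"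
      using p by simp
  qed
qed

end

section \<open>Pole orders at the singular points and analyticity elsewhere\<close>

theorem theorem1p1:
  fixes k :: nat
  assumes "k \<ge> 2"
  shows "\<exists>F :: complex \<Rightarrow> complex.
           F meromorphic_on UNIV \<and>
           (\<forall>s. Re s > 1 \<longrightarrow> F s = wigert_series k s) \<and>
           has_pole_of_order F 1 2 \<and>
           has_pole_of_order F (1 / of_nat k) 1 \<and>
           (\<forall>n. \<not> (k dvd 2 * n + 2) \<longrightarrow> has_pole_of_order F (wigert_point k n) 1) \<and>
           F holomorphic_on
             (- ({1, 1 / of_nat k} \<union> {wigert_point k n | n. \<not> (k dvd 2 * n + 2)}))"
proof -
  note k = assms
  have k0: "of_nat k \<noteq> (0 :: complex)" using k by simp
  obtain F where F: "F nicely_meromorphic_on UNIV" "\<forall>s. Re s > 1 \<longrightarrow> F s = wigert_series k s"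
    and sing: "\<forall>j p. zeta_arg k j p = 1 \<longrightarrow> (\<exists>\<psi>. \<psi> analytic_on {p} \<and>
        \<psi> p = of_real (bernoulli_coeff j) * em_factor j p / of_nat k \<and>
        (\<forall>\<^sub>F s in at p. F s = \<psi> s / ((s - p) * (s - 1))))"
    and regular: "\<forall>p. (\<forall>j. zeta_arg k j p \<noteq> 1) \<longrightarrow> (\<exists>\<psi>. \<psi> analytic_on {p} \<and> \<psi> p = 0 \<and>
        (\<forall>\<^sub>F s in at p. F s = \<psi> s / ((s - p) * (s - 1))))"
    using wigert_series_continuation[OF k] by (elim exE conjE)
  note sing = sing[rule_format]
  \<comment> \<open>For \<open>p \<noteq> 1\<close> the factor \<open>1 / (s - 1)\<close> is
    analytic and nonzero at \<open>p\<close>, so the numerator absorbs it.\<close>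
  have simple_pole: "has_pole_of_order F p 1"
    if p: "zeta_arg k j p = 1" "bernoulli_coeff j \<noteq> 0" "em_factor j p \<noteq> 0" "p \<noteq> 1" for j p
  proof -
    obtain \<psi> where \<psi>: "\<psi> analytic_on {p}" "\<psi> p = of_real (bernoulli_coeff j) * em_factor j p / of_nat k"
      "\<forall>\<^sub>F s in at p. F s = \<psi> s / ((s - p) * (s - 1))"
      using sing[OF p(1)] by blast
    show ?thesis
    proof (rule has_pole_of_orderI)
      show "(\<lambda>s. \<psi> s / (s - 1)) analytic_on {p}"
        using p(4) by (intro analytic_on_divide analytic_on_diff analytic_on_const analytic_on_ident \<psi>) auto
      show "\<forall>\<^sub>F s in at p. F s = \<psi> s / (s - 1) / (s - p) ^ 1"
        using \<psi>(3) by (simp add: mult.commute)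
    qed (use p k0 \<psi>(2) in auto)
  qed
  have "has_pole_of_order F 1 2"
  proof -
    \<comment> \<open>The index is \<open>j = 0\<close>, whose Bernoulli coefficient and
      \<open>em_factor\<close> are both 1.\<close>
    obtain \<psi> where \<psi>: "\<psi> analytic_on {1}" "\<psi> 1 = 1 / of_nat k"
      "\<forall>\<^sub>F s in at 1. F s = \<psi> s / ((s - 1) * (s - 1))"
      using sing[OF zeta_arg_0_1[OF k]] by auto
    show ?thesis
      by (rule has_pole_of_orderI[OF \<psi>(1)]) (use \<psi> k0 in \<open>auto simp: power2_eq_square\<close>)
  qed
  moreover have "has_pole_of_order F (1 / of_nat k) 1"
  proof (rule simple_pole[OF zeta_arg_1[OF k]])
    show "1 / of_nat k \<noteq> (1 :: complex)" using k by auto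
    thus "em_factor 1 (1 / of_nat k) \<noteq> 0" by (auto simp: em_factor_def)
    show "bernoulli_coeff 1 \<noteq> 0" unfolding bernoulli_coeff_1 by simp
  qed
  moreover have "has_pole_of_order F (wigert_point k n) 1" if n: "\<not> k dvd 2 * n + 2" for n
  proof (rule simple_pole)
    show z: "zeta_arg k (2 * n + 2) (wigert_point k n) = 1"
      by (simp only: zeta_arg_even_eq_1_iff[OF k])
    show "em_factor (2 * n + 2) (wigert_point k n) \<noteq> 0"
      using n by (simp only: em_factor_wigert_point[OF k]) simp
    \<comment> \<open>The point 1 already belongs to the index 0, and each point has only one
      index.\<close>
    show "wigert_point k n \<noteq> 1"
      using z zeta_arg_0_1[OF k] zeta_arg_eq_1_unique[OF k, of "2 * n + 2" 1 0] by auto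
    show "bernoulli_coeff (2 * n + 2) \<noteq> 0" by (rule bernoulli_coeff_even_nonzero) simp
  qed
  \<comment> \<open>Off the listed points either no zeta term is singular or the singular one has
    coefficient 0: for odd \<open>j > 1\<close> the Bernoulli coefficient vanishes, for even
    \<open>j\<close> the number \<open>k\<close> divides \<open>j\<close> and
    \<open>em_factor\<close> vanishes.\<close>
  moreover have "F analytic_on {p}"
    if p: "p \<notin> {1, 1 / of_nat k} \<union> {wigert_point k n | n. \<not> (k dvd 2 * n + 2)}" for p
  proof -
    have "\<exists>\<psi>. \<psi> analytic_on {p} \<and> \<psi> p = 0 \<and> (\<forall>\<^sub>F s in at p. F s = \<psi> s / ((s - p) * (s - 1)))"
    proof (cases "\<exists>j. zeta_arg k j p = 1")
      case True
      then obtain j where j: "zeta_arg k j p = 1" by blast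
      have j0: "j \<noteq> 0"
      proof
        assume "j = 0"
        hence "p = 1" using j k0 by (simp add: zeta_arg_eq_1_iff[OF k])
        with p show False by blast
      qed
      have j1: "j \<noteq> 1"
      proof
        assume "j = 1"
        hence "p = 1 / of_nat k" using j by (simp add: zeta_arg_eq_1_iff[OF k])
        with p show False by blast
      qed
      from j0 have "odd j \<or> (\<exists>n. j = 2 * n + 2)" by presburger
      with j1 consider "odd j" "j \<noteq> 1" | n where "j = 2 * n + 2" by blast
      hence "bernoulli_coeff j = 0 \<or> em_factor j p = 0"
      proof cases
        case 1
        thus ?thesis by (simp add: bernoulli_coeff_odd)
      next
        case (2 n)
        hence "p = wigert_point k n" using j by (simp only: zeta_arg_even_eq_1_iff[OF k])
        moreover from this have "k dvd 2 * n + 2" using p by blast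
        ultimately show ?thesis using 2 em_factor_wigert_point[OF k, of n] by simp
      qed
      thus ?thesis using sing[OF j] by auto
    next
      case False
      thus ?thesis using regular by blast
    qed
    then obtain \<psi> where \<psi>: "\<psi> analytic_on {p}" "\<psi> p = 0" "\<forall>\<^sub>F s in at p. F s = \<psi> s / ((s - p) * (s - 1))"
      by blast
    have "\<not> is_pole F p"
    proof (rule not_is_pole_if_numerator_zero)
      show "(\<lambda>s. \<psi> s / (s - 1)) analytic_on {p}"
        using p by (intro analytic_on_divide analytic_on_diff analytic_on_const analytic_on_ident \<psi>) auto
      show "\<forall>\<^sub>F s in at p. F s = \<psi> s / (s - 1) / (s - p)"
        using \<psi>(3) by (simp add: mult.commute)
    qed (use \<psi>(2) in simp)
    \<comment> \<open>A nicely meromorphic function takes its limit as value wherever it has no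
      pole, so it is analytic there.\<close>
    thus ?thesis using F(1) nicely_meromorphic_on_imp_analytic_at by blast
  qed
  hence "F holomorphic_on (- ({1, 1 / of_nat k} \<union> {wigert_point k n | n. \<not> (k dvd 2 * n + 2)}))"
    by (intro analytic_imp_holomorphic) (subst analytic_on_analytic_at, blast)
  moreover have "F meromorphic_on UNIV"
    using F(1) by (simp add: nicely_meromorphic_on_def)
  ultimately show ?thesis using F(2) by (intro exI[of _ F] conjI allI impI) blast+
qed

end
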